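(* Let $X$ be a random variable whose cumulative distribution function $F$ is absolutely continuous with respect to Lebesgue measure, and assume $E|X|<\infty$. Let $n\ge 3$ be an integer, let $X_1,\dots,X_n$ be independent random variables with common cumulative distribution function $F$, and let $X_{1:n}\le X_{2:n}\le\dots\le X_{n:n}$ be the corresponding order statistics. Then $X$ belongs to the $Q$-family if and only if for some integer $k$ with $2\le k\le n-1$ and some $0<\lambda<1$ $$\lambda\, E\left[\frac{1}{k-1}\sum_{i=1}^{k-1}(X_{k:n}-X_{i:n})\ \Big|\ X_{k:n}=x\right]=(1-\lambda)\,E\left[\frac{1}{n-k}\sum_{j=k+1}^{n}(X_{j:n}-X_{k:n})\ \Big|\ X_{k:n}=x\right].$$
   Context: The quantile function $Q$ of a random variable with cumulative distribution function $F$ is the function satisfying $F(Q(x))=x$ for $0<x<1$. The $Q$-family is the family of probability distributions whose quantile function is, for some $0<\lambda<1$, $0<c<\infty$ and $-\infty<d<\infty$, of the form $$Q_\lambda(x)=\frac{c(x-\lambda)}{\lambda(1-\lambda)(1-x)^{\lambda}x^{1-\lambda}}+d,\qquad 0<x<1.$$ A random variable belongs to the $Q$-family if its distribution does. The displayed identity of conditional expectations is an identity between functions of $x$, holding for almost every $x$ with respect to the distribution of $X_{k:n}$. *)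

theory Defs
  imports "HOL-Probability.Probability"
begin

definition has_quantile_function :: "real measure \<Rightarrow> (real \<Rightarrow> real) \<Rightarrow> bool" where
  "has_quantile_function \<mu> Q \<longleftrightarrow> (\<forall>x\<in>{0<..<1}. cdf \<mu> (Q x) = x)"

text \<open>For \<open>0 < lam < 1\<close> and \<open>c > 0\<close> the function below is an increasing bijection from \<open>(0,1)\<close> onto the
  reals, so being its quantile function in the above sense determines the distribution.\<close>

definition Q_fun :: "real \<Rightarrow> real \<Rightarrow> real \<Rightarrow> real \<Rightarrow> real" where
  "Q_fun lam c d x = c * (x - lam) / (lam * (1 - lam) * (1 - x) powr lam * x powr (1 - lam)) + d"

definition Q_family :: "real measure set" where
  "Q_family = {\<mu>. real_distribution \<mu> \<and>
     (\<exists>lam c d. 0 < lam \<and> lam < 1 \<and> 0 < c \<and> has_quantile_function \<mu> (Q_fun lam c d))}"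

text \<open>Order statistics are numbered from 1: the \<open>k\<close>-th smallest of the values
  \<open>X 1 \<omega>, \<dots>, X n \<omega>\<close>, for \<open>1 \<le> k \<le> n\<close>.\<close>

definition order_stat :: "(nat \<Rightarrow> 'a \<Rightarrow> real) \<Rightarrow> nat \<Rightarrow> nat \<Rightarrow> 'a \<Rightarrow> real" where
  "order_stat X n k \<omega> = sort (map (\<lambda>i. X i \<omega>) [1..<Suc n]) ! (k - 1)"

text \<open>A version of \<open>x \<mapsto> E[Y | Z = x]\<close>: a Borel function \<open>g\<close> such that \<open>g \<circ> Z\<close> is the conditional
  expectation of \<open>Y\<close> given the \<open>\<sigma>\<close>-algebra generated by \<open>Z\<close>. Any two choices of \<open>g\<close> agree almost
  everywhere with respect to the distribution of \<open>Z\<close>; existence is shown below.\<close>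

definition cond_exp_at :: "'a measure \<Rightarrow> ('a \<Rightarrow> real) \<Rightarrow> ('a \<Rightarrow> real) \<Rightarrow> real \<Rightarrow> real" where
  "cond_exp_at M Y Z = (SOME g. g \<in> borel_measurable borel \<and>
     (AE \<omega> in M. g (Z \<omega>) = real_cond_exp M (vimage_algebra (space M) Z borel) Y \<omega>))"

lemma vimage_algebra_factor_ennreal:
  fixes f :: "'a \<Rightarrow> ennreal" and Z :: "'a \<Rightarrow> real"
  assumes "f \<in> borel_measurable (vimage_algebra S Z borel)"
  shows "\<exists>g\<in>borel_measurable borel. \<forall>\<omega>\<in>S. f \<omega> = g (Z \<omega>)"
  using assms
proof (induction rule: borel_measurable_induct)
  case (cong f g)
  then show ?case by (metis space_vimage_algebra)
next
  case (set A)
  then obtain B where B: "B \<in> sets borel" "A = Z -` B \<inter> S"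
    by (auto simp: sets_vimage_algebra2)
  show ?case
    by (rule bexI[of _ "indicator B"]) (use B in \<open>auto simp: indicator_def\<close>)
next
  case (mult u c)
  then obtain g where "g \<in> borel_measurable borel" "\<forall>\<omega>\<in>S. u \<omega> = g (Z \<omega>)" by blast
  then show ?case by (intro bexI[of _ "\<lambda>x. c * g x"]) auto
next
  case (add u v)
  then obtain g h where "g \<in> borel_measurable borel" "\<forall>\<omega>\<in>S. u \<omega> = g (Z \<omega>)"
    "h \<in> borel_measurable borel" "\<forall>\<omega>\<in>S. v \<omega> = h (Z \<omega>)" by blast
  then show ?case by (intro bexI[of _ "\<lambda>x. h x + g x"]) auto
next
  case (seq U)
  then obtain g where g: "\<And>i. g i \<in> borel_measurable borel"
    "\<And>i \<omega>. \<omega> \<in> S \<Longrightarrow> U i \<omega> = g i (Z \<omega>)" by metis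
  then show ?case by (intro bexI[of _ "\<lambda>x. SUP i. g i x"]) (auto simp: SUP_apply image_comp)
qed

lemma
  fixes Y Z :: "'a \<Rightarrow> real"
  shows borel_measurable_cond_exp_at: "cond_exp_at M Y Z \<in> borel_measurable borel"
    and AE_cond_exp_at:
      "AE \<omega> in M. cond_exp_at M Y Z (Z \<omega>) = real_cond_exp M (vimage_algebra (space M) Z borel) Y \<omega>"
proof -
  let ?F = "vimage_algebra (space M) Z borel"
  obtain g where g: "g \<in> borel_measurable borel"
    "\<forall>\<omega>\<in>space M. nn_cond_exp M ?F (\<lambda>\<omega>. ennreal (Y \<omega>)) \<omega> = g (Z \<omega>)"
    using vimage_algebra_factor_ennreal[OF borel_measurable_nn_cond_exp] by metis
  obtain h where h: "h \<in> borel_measurable borel"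
    "\<forall>\<omega>\<in>space M. nn_cond_exp M ?F (\<lambda>\<omega>. ennreal (- Y \<omega>)) \<omega> = h (Z \<omega>)"
    using vimage_algebra_factor_ennreal[OF borel_measurable_nn_cond_exp] by metis
  have "(\<lambda>x. enn2real (g x) - enn2real (h x)) \<in> borel_measurable borel"
    using g h by measurable
  moreover have "AE \<omega> in M. enn2real (g (Z \<omega>)) - enn2real (h (Z \<omega>)) = real_cond_exp M ?F Y \<omega>"
    using g h by (intro AE_I2) (simp add: real_cond_exp_def)
  ultimately have "\<exists>g. g \<in> borel_measurable borel \<and>
     (AE \<omega> in M. g (Z \<omega>) = real_cond_exp M ?F Y \<omega>)"
    by blast
  from someI_ex[OF this]
  show "cond_exp_at M Y Z \<in> borel_measurable borel"
    "AE \<omega> in M. cond_exp_at M Y Z (Z \<omega>) = real_cond_exp M ?F Y \<omega>"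
    by (simp_all add: cond_exp_at_def)
qed

end

theory Submission
  imports Defs
begin

text \<open>
  Let \<open>\<mu>\<close> be the law of \<open>X\<close> and \<open>F\<close> its distribution function. Given that \<open>X\<^bsub>k:n\<^esub> = x\<close>, the
  \<open>k - 1\<close> smaller observations are an independent sample from the law of \<open>X\<close> given \<open>X < x\<close>, and the
  \<open>n - k\<close> larger ones are an independent sample from the law of \<open>X\<close> given \<open>X > x\<close>. Hence the two
  conditional expectations are \<open>x - E[X | X < x]\<close> and \<open>E[X | X > x] - x\<close>, whatever \<open>n\<close> and \<open>k\<close> are
  (\<open>AE_cond_exp_lower_gaps\<close>, \<open>AE_cond_exp_upper_gaps\<close>). Moreover the laws of \<open>X\<^bsub>k:n\<^esub>\<close> and of
  \<open>X\<close> have the same null sets (\<open>AE_order_stat_iff\<close>), so the identity is a condition on \<open>\<mu>\<close> alone: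
  \<open>lam * (x - E[X | X < x]) = (1 - lam) * (E[X | X > x] - x)\<close> for \<open>\<mu>\<close>-almost every \<open>x\<close>.

  The conditional law is made precise without densities. Apart from a null set there are no
  ties, and then exactly one pair \<open>(r, S)\<close> has the property that \<open>X\<^sub>r\<close> is the \<open>k\<close>-th smallest
  observation and \<open>S\<close> is the set of indices of the smaller ones (\<open>rank_pair_unique\<close>). The indicator of
  this event is a product of factors depending on \<open>X\<^sub>r\<close> and one other observation each, so Fubini
  (\<open>nn_integral_iid_conditioning\<close>) lets one replace \<open>\<bar>X\<^sub>r - X\<^sub>j\<bar>\<close> by its conditional mean on
  each event separately (\<open>nn_integral_rank_event\<close>); summing over all pairs gives the claim, and
  binomial coefficients never appear.

  For the analytic half, put \<open>x = Q u\<close> with the quantile function \<open>Q\<close> and let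
  \<open>G u = \<integral>\<^sub>0\<^sup>u Q\<close>, so that \<open>G 1 = E X\<close>. The condition becomes
  \<open>Q u = lam * G u / u + (1 - lam) * (G 1 - G u) / (1 - u)\<close> for almost every \<open>u\<close> in \<open>(0,1)\<close>
  (\<open>balance_at_quantile_iff\<close>). The right-hand side is continuous in \<open>u\<close> and \<open>Q\<close> is increasing, so the
  equation holds everywhere and \<open>Q\<close> is continuous; now \<open>G' = Q\<close> and the equation is a linear
  differential equation for \<open>G\<close>. Its solutions are \<open>G u = m * u - C * u powr lam * (1 - u) powr (1 - lam)\<close> with
  \<open>m = G 1\<close>, whose derivatives are exactly the functions \<open>Q_fun lam c m\<close> with
  \<open>c = C * lam * (1 - lam)\<close>; strict monotonicity of \<open>Q\<close> forces \<open>C > 0\<close>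
  (\<open>Q_fun_if_balance\<close>). Conversely \<open>Q_fun lam c d\<close> solves the equation by direct integration
  (\<open>balance_if_Q_fun\<close>). The parameter \<open>lam\<close> of the family and that of the identity are the same.
\<close>

section \<open>Order statistics and ranks\<close>

definition side :: "nat set \<Rightarrow> nat \<Rightarrow> real \<Rightarrow> real set" where
  "side S i x = (if i \<in> S then {..<x} else {x<..})"

text \<open>The indicator of the event that the observations with index in \<open>S\<close> lie below the \<open>r\<close>-th and all
  other ones above it. It is a product, rather than the indicator of an intersection, so that it
  factorizes under independence as it stands.\<close>
definition rank_event :: "nat set \<Rightarrow> nat \<Rightarrow> nat set \<Rightarrow> (nat \<Rightarrow> real) \<Rightarrow> ennreal" where
  "rank_event I r S x = (\<Prod>i\<in>I - {r}. indicator (side S i (x r)) (x i))"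

text \<open>Sorting permutes the sample, so symmetric sums can be computed from either. Everything below
  about ranks is obtained by choosing \<open>f\<close>.\<close>
lemma sum_order_stat:
  fixes f :: "real \<Rightarrow> 'b::comm_monoid_add"
  shows "(\<Sum>i=1..n. f (order_stat X n i \<omega>)) = (\<Sum>i=1..n. f (X i \<omega>))"
proof -
  let ?xs = "map (\<lambda>i. X i \<omega>) [1..<Suc n]"
  have "(\<Sum>i=1..n. f (order_stat X n i \<omega>)) = (\<Sum>i<n. f (sort ?xs ! i))"
    unfolding order_stat_def
    by (rule sum.reindex_bij_witness[of _ Suc "\<lambda>i. i - 1"]) (auto simp del: upt_Suc)
  also have "\<dots> = sum_list (map f (sort ?xs))"
    by (simp add: sum_list_sum_nth atLeast0LessThan del: upt_Suc)
  also have "\<dots> = sum_list (map f ?xs)"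
    by (simp only: flip: sum_mset_sum_list mset_map) (simp add: multiset.map_comp comp_def del: upt_Suc)
  also have "\<dots> = (\<Sum>i=1..n. f (X i \<omega>))"
    by (simp add: comp_def interv_sum_list_conv_sum_set_nat atLeastLessThanSuc_atLeastAtMost del: upt_Suc)
  finally show ?thesis .
qed

lemma order_stat_mono:
  assumes "1 \<le> i" "i \<le> j" "j \<le> n"
  shows "order_stat X n i \<omega> \<le> order_stat X n j \<omega>"
  unfolding order_stat_def using assms by (intro sorted_nth_mono) auto

lemma order_stat_strict_mono:
  assumes "1 \<le> i" "i < j" "j \<le> n" "inj_on (\<lambda>i. X i \<omega>) {1..n}"
  shows "order_stat X n i \<omega> < order_stat X n j \<omega>"
proof -
  let ?ys = "sort (map (\<lambda>i. X i \<omega>) [1..<Suc n])"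
  have "distinct ?ys"
    using assms(4) by (simp add: distinct_map atLeastLessThanSuc_atLeastAtMost del: upt_Suc)
  then have "order_stat X n i \<omega> \<noteq> order_stat X n j \<omega>"
    unfolding order_stat_def using assms by (subst nth_eq_iff_index_eq) auto
  with order_stat_mono[of i j n X \<omega>] assms show ?thesis by simp
qed

lemma order_stat_in_sample:
  assumes "1 \<le> k" "k \<le> n"
  obtains r where "r \<in> {1..n}" "order_stat X n k \<omega> = X r \<omega>"
proof -
  have "order_stat X n k \<omega> \<in> set (sort (map (\<lambda>i. X i \<omega>) [1..<Suc n]))"
    unfolding order_stat_def using assms by (intro nth_mem) auto
  then show ?thesis using that by (auto simp: atLeastLessThanSuc_atLeastAtMost simp del: upt_Suc)
qed

text \<open>By \<open>sum_order_stat\<close> the observations below the \<open>k\<close>-th order statistic are as many as the order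
  statistics below it, and without ties these are the first \<open>k - 1\<close>.\<close>
lemma card_below_order_stat:
  assumes "1 \<le> k" "k \<le> n" "inj_on (\<lambda>i. X i \<omega>) {1..n}"
  shows "card {i\<in>{1..n}. X i \<omega> < order_stat X n k \<omega>} = k - 1"
proof -
  let ?Z = "\<lambda>i. order_stat X n i \<omega>"
  have "card {i\<in>{1..n}. X i \<omega> < ?Z k} = (\<Sum>i=1..n. if X i \<omega> < ?Z k then 1 else 0)"
    by (simp add: sum.If_cases Int_def)
  also have "\<dots> = (\<Sum>i=1..n. if ?Z i < ?Z k then 1 else 0)"
    by (rule sum_order_stat[where f="\<lambda>z. if z < ?Z k then 1 else 0", symmetric])
  also have "\<dots> = card {i\<in>{1..n}. ?Z i < ?Z k}"
    by (simp add: sum.If_cases Int_def)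
  also have "{i\<in>{1..n}. ?Z i < ?Z k} = {1..k - 1}"
  proof -
    have "?Z i < ?Z k \<longleftrightarrow> i < k" if "i \<in> {1..n}" for i
    proof (cases "i < k")
      case True
      then show ?thesis using order_stat_strict_mono[where X=X and \<omega>=\<omega>, OF _ _ assms(2,3), of i] that by simp
    next
      case False
      then show ?thesis using order_stat_mono[OF assms(1), of i n X \<omega>] that by simp
    qed
    then show ?thesis using assms by auto
  qed
  finally show ?thesis by simp
qed

text \<open>Writing the gaps as positive parts turns a sum over ranks into a sum over the whole sample.
  This holds even with ties, since a tied observation contributes nothing.\<close>
lemma sum_lower_gaps:
  assumes "1 \<le> k" "k \<le> n"
  shows "(\<Sum>i=1..k-1. order_stat X n k \<omega> - order_stat X n i \<omega>) =
    (\<Sum>i=1..n. max 0 (order_stat X n k \<omega> - X i \<omega>))"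
proof -
  let ?Z = "\<lambda>i. order_stat X n i \<omega>"
  have "(\<Sum>i=1..n. max 0 (?Z k - X i \<omega>)) = (\<Sum>i=1..n. max 0 (?Z k - ?Z i))"
    by (rule sum_order_stat[where f="\<lambda>z. max 0 (?Z k - z)", symmetric])
  also have "\<dots> = (\<Sum>i=1..k-1. ?Z k - ?Z i)"
    using assms by (intro sum.mono_neutral_cong_right) (auto intro!: max_absorb1 max_absorb2 order_stat_mono)
  finally show ?thesis by simp
qed

lemma sum_upper_gaps:
  assumes "1 \<le> k" "k \<le> n"
  shows "(\<Sum>i=k+1..n. order_stat X n i \<omega> - order_stat X n k \<omega>) =
    (\<Sum>i=1..n. max 0 (X i \<omega> - order_stat X n k \<omega>))"
proof -
  let ?Z = "\<lambda>i. order_stat X n i \<omega>"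
  have "(\<Sum>i=1..n. max 0 (X i \<omega> - ?Z k)) = (\<Sum>i=1..n. max 0 (?Z i - ?Z k))"
    by (rule sum_order_stat[where f="\<lambda>z. max 0 (z - ?Z k)", symmetric])
  also have "\<dots> = (\<Sum>i=k+1..n. ?Z i - ?Z k)"
    using assms by (intro sum.mono_neutral_cong_right) (auto intro!: max_absorb1 max_absorb2 order_stat_mono)
  finally show ?thesis by simp
qed

definition rank_pairs :: "nat \<Rightarrow> nat \<Rightarrow> (nat \<times> nat set) set" where
  "rank_pairs n k = (SIGMA r:{1..n}. {S. S \<subseteq> {1..n} - {r} \<and> card S = k - 1})"

lemma rank_event_eq:
  assumes "finite I" "S \<subseteq> I - {r}"
  shows "rank_event I r S x =
    (if (\<forall>i\<in>S. x i < x r) \<and> (\<forall>i\<in>I - {r} - S. x r < x i) then 1 else 0)"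
proof (cases "(\<forall>i\<in>S. x i < x r) \<and> (\<forall>i\<in>I - {r} - S. x r < x i)")
  case True
  then show ?thesis unfolding rank_event_def by (auto simp: side_def intro!: prod.neutral)
next
  case False
  then have "\<exists>i\<in>I - {r}. x i \<notin> side S i (x r)"
    using assms(2) by (auto simp: side_def subset_iff)
  then obtain i where "i \<in> I - {r}" "x i \<notin> side S i (x r)" by blast
  then have "rank_event I r S x = 0"
    unfolding rank_event_def using assms by (intro prod_zero) (auto intro!: bexI[of _ i])
  with False show ?thesis by simp
qed

text \<open>Without ties, \<open>r\<close> has to be the index of the \<open>k\<close>-th smallest observation and \<open>S\<close> the set of
  indices of the smaller ones. Uniqueness comes from counting: an observation other than the \<open>k\<close>-th
  smallest has strictly more or strictly fewer than \<open>k - 1\<close> observations below it.\<close>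
lemma rank_pair_unique:
  assumes k: "1 \<le> k" "k \<le> n" and inj: "inj_on (\<lambda>i. X i \<omega>) {1..n}"
  obtains r S where "(r, S) \<in> rank_pairs n k"
    "\<And>r' S'. (r', S') \<in> rank_pairs n k \<Longrightarrow>
      rank_event {1..n} r' S' (\<lambda>i. X i \<omega>) = (if (r', S') = (r, S) then 1 else 0)"
    "order_stat X n k \<omega> = X r \<omega>"
    "(\<Sum>i=1..k-1. order_stat X n k \<omega> - order_stat X n i \<omega>) = (\<Sum>j\<in>S. \<bar>X r \<omega> - X j \<omega>\<bar>)"
    "(\<Sum>i=k+1..n. order_stat X n i \<omega> - order_stat X n k \<omega>) =
      (\<Sum>j\<in>{1..n} - {r} - S. \<bar>X r \<omega> - X j \<omega>\<bar>)"
proof -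
  obtain r where r: "r \<in> {1..n}" "order_stat X n k \<omega> = X r \<omega>"
    using order_stat_in_sample[OF k] by metis
  define S where "S = {i\<in>{1..n}. X i \<omega> < X r \<omega>}"
  have card_S: "card S = k - 1"
    using card_below_order_stat[where X=X and \<omega>=\<omega>, OF k inj] r by (simp add: S_def)
  have above: "X r \<omega> < X i \<omega>" if "i \<in> {1..n} - {r} - S" for i
  proof -
    have "X i \<omega> \<noteq> X r \<omega>" "\<not> X i \<omega> < X r \<omega>"
      using inj_onD[OF inj, of i r] that r(1) by (auto simp: S_def)
    then show ?thesis by simp
  qed
  have pair: "(r, S) \<in> rank_pairs n k"
    using r card_S by (auto simp: rank_pairs_def S_def)
  show ?thesis
  proof (rule that[OF pair _ r(2)])
    fix r' S' assume p: "(r', S') \<in> rank_pairs n k"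
    have "(r', S') = (r, S)" if *: "\<forall>i\<in>S'. X i \<omega> < X r' \<omega>" "\<forall>i\<in>{1..n} - {r'} - S'. X r' \<omega> < X i \<omega>"
    proof -
      have S': "S' = {i\<in>{1..n}. X i \<omega> < X r' \<omega>}"
      proof (intro set_eqI iffI)
        fix i assume "i \<in> S'"
        then show "i \<in> {i\<in>{1..n}. X i \<omega> < X r' \<omega>}" using *(1) p by (auto simp: rank_pairs_def)
      next
        fix i assume i: "i \<in> {i\<in>{1..n}. X i \<omega> < X r' \<omega>}"
        show "i \<in> S'"
        proof (rule ccontr)
          assume "i \<notin> S'"
          moreover have "i \<noteq> r'" using i by auto
          ultimately have "X r' \<omega> < X i \<omega>" using *(2) i by blast
          then show False using i by simp
        qed
      qed
      have card': "card S' = card S" using p card_S by (simp add: rank_pairs_def)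
      have r': "r' \<in> {1..n}" using p by (simp add: rank_pairs_def)
      have "\<not> X r' \<omega> < X r \<omega>"
      proof
        assume "X r' \<omega> < X r \<omega>"
        then have "S' \<subset> S" using r' by (auto simp: S' S_def)
        then show False using card' psubset_card_mono[of S S'] by (simp add: S_def)
      qed
      moreover have "\<not> X r \<omega> < X r' \<omega>"
      proof
        assume "X r \<omega> < X r' \<omega>"
        then have "S \<subset> S'" using r by (auto simp: S' S_def)
        then show False using card' psubset_card_mono[of S' S] by (simp add: S')
      qed
      ultimately have "X r' \<omega> = X r \<omega>" by simp
      then have "r' = r" using inj_onD[OF inj _ r' r(1)] by simp
      then show ?thesis using S' S_def by simp
    qed
    moreover have "(\<forall>i\<in>S. X i \<omega> < X r \<omega>) \<and> (\<forall>i\<in>{1..n} - {r} - S. X r \<omega> < X i \<omega>)"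
      using above by (simp add: S_def)
    ultimately have "(\<forall>i\<in>S'. X i \<omega> < X r' \<omega>) \<and> (\<forall>i\<in>{1..n} - {r'} - S'. X r' \<omega> < X i \<omega>)
        \<longleftrightarrow> (r', S') = (r, S)" by blast
    then show "rank_event {1..n} r' S' (\<lambda>i. X i \<omega>) = (if (r', S') = (r, S) then 1 else 0)"
      using p by (subst rank_event_eq) (simp_all add: rank_pairs_def)
  next
    show "(\<Sum>i=1..k-1. order_stat X n k \<omega> - order_stat X n i \<omega>) = (\<Sum>j\<in>S. \<bar>X r \<omega> - X j \<omega>\<bar>)"
      unfolding sum_lower_gaps[OF k] unfolding r(2)
      by (intro sum.mono_neutral_cong_right) (auto simp: S_def)
    show "(\<Sum>i=k+1..n. order_stat X n i \<omega> - order_stat X n k \<omega>) =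
      (\<Sum>j\<in>{1..n} - {r} - S. \<bar>X r \<omega> - X j \<omega>\<bar>)"
      unfolding sum_upper_gaps[OF k] unfolding r(2) using above
      by (intro sum.mono_neutral_cong_right) (auto simp: S_def dest: less_imp_le)
  qed
qed

lemma sum_rank_events:
  assumes "1 \<le> k" "k \<le> n" "inj_on (\<lambda>i. X i \<omega>) {1..n}"
  shows "(\<Sum>(r, S)\<in>rank_pairs n k. rank_event {1..n} r S (\<lambda>i. X i \<omega>)) = 1"
proof -
  obtain r S where *: "(r, S) \<in> rank_pairs n k"
    "\<And>r' S'. (r', S') \<in> rank_pairs n k \<Longrightarrow>
      rank_event {1..n} r' S' (\<lambda>i. X i \<omega>) = (if (r', S') = (r, S) then 1 else 0)"
    by (rule rank_pair_unique[where X=X and \<omega>=\<omega>, OF assms]) (rule that; assumption)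
  have "(\<Sum>(r, S)\<in>rank_pairs n k. rank_event {1..n} r S (\<lambda>i. X i \<omega>)) =
    (\<Sum>p\<in>rank_pairs n k. if p = (r, S) then 1 else 0)"
  proof (intro sum.cong refl, clarify)
    fix r' S' assume "(r', S') \<in> rank_pairs n k"
    from *(2)[OF this] show "rank_event {1..n} r' S' (\<lambda>i. X i \<omega>) = (if (r', S') = (r, S) then 1 else 0)" .
  qed
  also have "finite (rank_pairs n k)"
    by (auto simp: rank_pairs_def)
  then have "(\<Sum>p\<in>rank_pairs n k. if p = (r, S) then 1 else 0) = (1::ennreal)"
    using *(1) by simp
  finally show ?thesis .
qed

lemma rank_event_order_stat:
  assumes "1 \<le> k" "k \<le> n" "inj_on (\<lambda>i. X i \<omega>) {1..n}"
    and "(r, S) \<in> rank_pairs n k" "rank_event {1..n} r S (\<lambda>i. X i \<omega>) \<noteq> 0"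
  shows "order_stat X n k \<omega> = X r \<omega>"
    "(\<Sum>i=1..k-1. order_stat X n k \<omega> - order_stat X n i \<omega>) = (\<Sum>j\<in>S. \<bar>X r \<omega> - X j \<omega>\<bar>)"
    "(\<Sum>i=k+1..n. order_stat X n i \<omega> - order_stat X n k \<omega>) =
      (\<Sum>j\<in>{1..n} - {r} - S. \<bar>X r \<omega> - X j \<omega>\<bar>)"
proof -
  obtain r' S' where *: "(r', S') \<in> rank_pairs n k"
    "\<And>r'' S''. (r'', S'') \<in> rank_pairs n k \<Longrightarrow>
      rank_event {1..n} r'' S'' (\<lambda>i. X i \<omega>) = (if (r'', S'') = (r', S') then 1 else 0)"
    "order_stat X n k \<omega> = X r' \<omega>"
    "(\<Sum>i=1..k-1. order_stat X n k \<omega> - order_stat X n i \<omega>) = (\<Sum>j\<in>S'. \<bar>X r' \<omega> - X j \<omega>\<bar>)"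
    "(\<Sum>i=k+1..n. order_stat X n i \<omega> - order_stat X n k \<omega>) =
      (\<Sum>j\<in>{1..n} - {r'} - S'. \<bar>X r' \<omega> - X j \<omega>\<bar>)"
    by (rule rank_pair_unique[where X=X and \<omega>=\<omega>, OF assms(1-3)]) (rule that; assumption)
  have "r = r'" "S = S'"
    using *(2)[OF assms(4)] assms(5) by (auto split: if_splits)
  with *(3-) show "order_stat X n k \<omega> = X r \<omega>"
    "(\<Sum>i=1..k-1. order_stat X n k \<omega> - order_stat X n i \<omega>) = (\<Sum>j\<in>S. \<bar>X r \<omega> - X j \<omega>\<bar>)"
    "(\<Sum>i=k+1..n. order_stat X n i \<omega> - order_stat X n k \<omega>) =
      (\<Sum>j\<in>{1..n} - {r} - S. \<bar>X r \<omega> - X j \<omega>\<bar>)" by blast+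
qed

text \<open>This expresses the events that determine measurability of an order statistic by a count of
  observations.\<close>
lemma order_stat_le_iff:
  assumes "1 \<le> k" "k \<le> n"
  shows "order_stat X n k \<omega> \<le> a \<longleftrightarrow> k \<le> (\<Sum>i=1..n. if X i \<omega> \<le> a then 1 else 0)"
proof -
  let ?Z = "\<lambda>i. order_stat X n i \<omega>"
  have "(\<Sum>i=1..n. if X i \<omega> \<le> a then 1 else 0) = (\<Sum>i=1..n. if ?Z i \<le> a then 1 else (0::nat))"
    by (rule sum_order_stat[where f="\<lambda>z. if z \<le> a then 1 else 0", symmetric])
  also have "\<dots> = card {i\<in>{1..n}. ?Z i \<le> a}"
    by (simp add: sum.If_cases Int_def)
  finally have eq: "(\<Sum>i=1..n. if X i \<omega> \<le> a then 1 else 0) = card {i\<in>{1..n}. ?Z i \<le> a}" .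
  show ?thesis
  proof (cases "?Z k \<le> a")
    case True
    have "{1..k} \<subseteq> {i\<in>{1..n}. ?Z i \<le> a}"
      using assms by (auto intro!: order_trans[OF order_stat_mono True])
    from card_mono[OF _ this] show ?thesis using True eq by simp
  next
    case False
    have "i < k" if "i \<in> {1..n}" "?Z i \<le> a" for i
    proof (rule ccontr)
      assume "\<not> i < k"
      then have "?Z k \<le> ?Z i" using that assms by (intro order_stat_mono) auto
      with False that show False by simp
    qed
    then have "{i\<in>{1..n}. ?Z i \<le> a} \<subseteq> {1..<k}" by auto
    from card_mono[OF _ this] show ?thesis using False eq assms by simp
  qed
qed

lemma measurable_order_stat:
  fixes X :: "nat \<Rightarrow> 'a \<Rightarrow> real"
  assumes "1 \<le> k" "k \<le> n" and [measurable]: "\<And>i. i \<in> {1..n} \<Longrightarrow> X i \<in> borel_measurable M"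
  shows "order_stat X n k \<in> borel_measurable M"
proof (subst borel_measurable_iff_le, intro allI)
  fix a
  have "{\<omega>\<in>space M. order_stat X n k \<omega> \<le> a} =
    {\<omega>\<in>space M. real k \<le> (\<Sum>i=1..n. if X i \<omega> \<le> a then 1 else 0)}"
  proof -
    have "real k \<le> (\<Sum>i=1..n. if X i \<omega> \<le> a then 1 else 0) \<longleftrightarrow> k \<le> (\<Sum>i=1..n. if X i \<omega> \<le> a then 1 else 0)" for \<omega>
    proof -
      have "real (\<Sum>i=1..n. if X i \<omega> \<le> a then 1 else 0) = (\<Sum>i=1..n. if X i \<omega> \<le> a then 1 else 0)"
        unfolding of_nat_sum by (intro sum.cong) auto
      then show ?thesis by (metis of_nat_le_iff)
    qed
    then show ?thesis using order_stat_le_iff[OF assms(1,2), of X] by simp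
  qed
  also have "\<dots> \<in> sets M" by measurable
  finally show "{\<omega>\<in>space M. order_stat X n k \<omega> \<le> a} \<in> sets M" .
qed

section \<open>Conditioning an independent sample on one of its members\<close>

text \<open>Conditionally on \<open>X\<^sub>r = x\<close> the other observations are still independent with law \<open>\<mu>\<close>, so the
  conditional mean of a product over them is the product of the means. Formally this is Fubini on the
  product measure, splitting off the coordinate \<open>r\<close>.\<close>
lemma (in prob_space) nn_integral_iid_conditioning:
  fixes Xs :: "'i \<Rightarrow> 'a \<Rightarrow> real" and h :: "real \<Rightarrow> ennreal" and f :: "'i \<Rightarrow> real \<Rightarrow> real \<Rightarrow> ennreal"
  assumes I: "finite I" "r \<in> I" and indep: "indep_vars (\<lambda>_. borel) Xs I"
    and distr: "\<And>i. i \<in> I \<Longrightarrow> distr M borel (Xs i) = \<mu>"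
    and h [measurable]: "h \<in> borel_measurable borel"
    and f [measurable]: "\<And>i. i \<in> I - {r} \<Longrightarrow> case_prod (f i) \<in> borel_measurable (borel \<Otimes>\<^sub>M borel)"
  shows "(\<integral>\<^sup>+\<omega>. h (Xs r \<omega>) * (\<Prod>i\<in>I - {r}. f i (Xs r \<omega>) (Xs i \<omega>)) \<partial>M) =
    (\<integral>\<^sup>+x. h x * (\<Prod>i\<in>I - {r}. \<integral>\<^sup>+t. f i x t \<partial>\<mu>) \<partial>\<mu>)"
proof -
  have rv [measurable]: "random_variable borel (Xs i)" if "i \<in> I" for i
    using indep that unfolding indep_vars_def by auto
  have "prob_space \<mu>"
    using distr[OF I(2)] rv[OF I(2)] prob_space_distr by metis
  then interpret \<mu>: prob_space \<mu> .
  have sets_\<mu> [measurable_cong]: "sets \<mu> = sets borel"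
    using distr[OF I(2)] by auto
  interpret P: product_sigma_finite "\<lambda>_::'i. \<mu>" by standard
  define J where "J = I - {r}"
  have J: "finite J" "r \<notin> J" "I = insert r J" using I by (auto simp: J_def)
  have f' [measurable]: "case_prod (f i) \<in> borel_measurable (borel \<Otimes>\<^sub>M borel)" if "i \<in> J" for i
    using f that by (auto simp: J_def)
  have f'' [measurable]: "(\<lambda>t. f i x t) \<in> borel_measurable borel" if "i \<in> J" for i x
    using f'[OF that] by simp
  define \<phi> where "\<phi> = (\<lambda>y. h (y r) * (\<Prod>i\<in>J. f i (y r) (y i)))"
  have comp [measurable]: "(\<lambda>y. y i) \<in> borel_measurable (PiM I (\<lambda>_. \<mu>))" if "i \<in> I" for i
    using measurable_component_singleton[OF that, of "\<lambda>_. \<mu>"] sets_\<mu> by (simp cong: measurable_cong_sets)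
  have fc: "(\<lambda>y. f i (y r) (y i)) \<in> borel_measurable (PiM I (\<lambda>_. \<mu>))" if "i \<in> J" for i
  proof -
    have "(\<lambda>y. (y r, y i)) \<in> measurable (PiM I (\<lambda>_. \<mu>)) (borel \<Otimes>\<^sub>M borel)"
      using comp[of r] comp[of i] J that by (intro measurable_Pair) auto
    from measurable_compose[OF this f'[OF that]] show ?thesis by simp
  qed
  have \<phi>_meas: "\<phi> \<in> borel_measurable (PiM I (\<lambda>_. \<mu>))"
    unfolding \<phi>_def
    using fc measurable_compose[OF comp[of r] h] I by (intro borel_measurable_times_ennreal borel_measurable_prod_ennreal) auto
  have *: "distr M (PiM I (\<lambda>_. borel)) (\<lambda>\<omega>. \<lambda>i\<in>I. Xs i \<omega>) = PiM I (\<lambda>_. \<mu>)"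
  proof -
    have "distr M (PiM I (\<lambda>_. borel)) (\<lambda>\<omega>. \<lambda>i\<in>I. Xs i \<omega>) = PiM I (\<lambda>i. distr M borel (Xs i))"
      using indep_vars_iff_distr_eq_PiM'[where I=I and X=Xs and M'="\<lambda>_. borel"] I indep rv by blast
    also have "\<dots> = PiM I (\<lambda>_. \<mu>)" by (intro PiM_cong) (auto simp: distr)
    finally show ?thesis .
  qed
  have sets_eq: "sets (PiM I (\<lambda>_. \<mu>)) = sets (PiM I (\<lambda>_. borel))"
    by (intro sets_PiM_cong) (auto simp: sets_\<mu>)
  have "(\<integral>\<^sup>+\<omega>. h (Xs r \<omega>) * (\<Prod>i\<in>J. f i (Xs r \<omega>) (Xs i \<omega>)) \<partial>M) = (\<integral>\<^sup>+\<omega>. \<phi> (\<lambda>i\<in>I. Xs i \<omega>) \<partial>M)"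
    using J by (intro nn_integral_cong) (auto simp: \<phi>_def intro!: prod.cong)
  also have "\<dots> = integral\<^sup>N (distr M (PiM I (\<lambda>_. borel)) (\<lambda>\<omega>. \<lambda>i\<in>I. Xs i \<omega>)) \<phi>"
    using \<phi>_meas sets_eq by (subst nn_integral_distr) (auto cong: measurable_cong_sets)
  also have "\<dots> = integral\<^sup>N (PiM (insert r J) (\<lambda>_. \<mu>)) \<phi>" using * J by simp
  also have "\<dots> = (\<integral>\<^sup>+x. (\<integral>\<^sup>+y. \<phi> (y(r := x)) \<partial>(PiM J (\<lambda>_. \<mu>))) \<partial>\<mu>)"
    using \<phi>_meas J by (intro P.product_nn_integral_insert_rev) auto
  also have "\<dots> = (\<integral>\<^sup>+x. h x * (\<Prod>i\<in>J. \<integral>\<^sup>+t. f i x t \<partial>\<mu>) \<partial>\<mu>)"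
  proof (intro nn_integral_cong)
    fix x
    have "(\<integral>\<^sup>+y. \<phi> (y(r := x)) \<partial>(PiM J (\<lambda>_. \<mu>))) = (\<integral>\<^sup>+y. h x * (\<Prod>i\<in>J. f i x (y i)) \<partial>(PiM J (\<lambda>_. \<mu>)))"
      using J by (intro nn_integral_cong) (auto simp: \<phi>_def intro!: arg_cong2[where f="(*)"] prod.cong)
    also have "\<dots> = h x * (\<integral>\<^sup>+y. (\<Prod>i\<in>J. f i x (y i)) \<partial>(PiM J (\<lambda>_. \<mu>)))"
    proof (intro nn_integral_cmult borel_measurable_prod_ennreal)
      fix i assume i: "i \<in> J"
      have "(\<lambda>y. y i) \<in> measurable (PiM J (\<lambda>_. \<mu>)) borel"
        using measurable_component_singleton[OF i, of "\<lambda>_. \<mu>"] sets_\<mu> by (simp cong: measurable_cong_sets)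
      from measurable_compose[OF this f''[OF i]]
      show "(\<lambda>y. f i x (y i)) \<in> borel_measurable (PiM J (\<lambda>_. \<mu>))" .
    qed
    also have "\<dots> = h x * (\<Prod>i\<in>J. \<integral>\<^sup>+t. f i x t \<partial>\<mu>)"
    proof -
      have "f i x \<in> borel_measurable \<mu>" if "i \<in> J" for i
        using f''[OF that] measurable_cong_sets[OF sets_\<mu> refl] by blast
      then show ?thesis using J P.product_nn_integral_prod[of J "\<lambda>i. f i x"] by simp
    qed
    finally show "(\<integral>\<^sup>+y. \<phi> (y(r := x)) \<partial>(PiM J (\<lambda>_. \<mu>))) = h x * (\<Prod>i\<in>J. \<integral>\<^sup>+t. f i x t \<partial>\<mu>)" .
  qed
  finally show ?thesis by (simp add: J_def)
qed

text \<open>The conditional mean of \<open>\<bar>x - X\<bar>\<close> given \<open>X \<in> A\<close>, for \<open>X\<close> with law \<open>\<mu>\<close>. If \<open>A\<close> is a null set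
  the value is \<open>0\<close>.\<close>
definition mean_dist :: "real measure \<Rightarrow> real set \<Rightarrow> real \<Rightarrow> ennreal" where
  "mean_dist \<mu> A x = (\<integral>\<^sup>+t. ennreal \<bar>x - t\<bar> * indicator A t \<partial>\<mu>) / emeasure \<mu> A"

lemma mean_dist_times:
  assumes "finite_measure \<mu>" "A \<in> sets \<mu>"
  shows "mean_dist \<mu> A x * emeasure \<mu> A = (\<integral>\<^sup>+t. ennreal \<bar>x - t\<bar> * indicator A t \<partial>\<mu>)"
proof (cases "emeasure \<mu> A = 0")
  case True
  then have "AE t in \<mu>. t \<notin> A" using assms by (intro AE_not_in) auto
  then have "(\<integral>\<^sup>+t. ennreal \<bar>x - t\<bar> * indicator A t \<partial>\<mu>) = (\<integral>\<^sup>+t. 0 \<partial>\<mu>)"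
    by (intro nn_integral_cong_AE) (auto elim: AE_mp simp: indicator_def)
  then show ?thesis using True by simp
next
  case False
  then show ?thesis
    using finite_measure.emeasure_finite[OF assms(1), of A] unfolding mean_dist_def
    by (simp add: ennreal_divide_times ennreal_divide_self top.not_eq_extremum)
qed

lemma measurable_indicator_side:
  "(\<lambda>(x, t). indicator (side S i x) t :: ennreal) \<in> borel_measurable (borel \<Otimes>\<^sub>M borel)"
proof -
  have "(\<lambda>(x, t). indicator (side S i x) t :: ennreal) =
    (\<lambda>p. if i \<in> S then if snd p < fst p then 1 else 0 else if fst p < snd p then 1 else 0)"
    by (auto simp: side_def fun_eq_iff)
  then show ?thesis by simp
qed

lemma measurable_mean_dist:
  assumes "prob_space \<mu>" "sets \<mu> = sets borel"
  shows "(\<lambda>x. mean_dist \<mu> (side S i x) x) \<in> borel_measurable borel"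
proof -
  interpret prob_space \<mu> by fact
  note assms(2)[measurable_cong] measurable_indicator_side[measurable]
  have 1: "emeasure \<mu> (side S i x) = (\<integral>\<^sup>+t. indicator (side S i x) t \<partial>\<mu>)" for x
    using assms by (simp add: side_def)
  have e: "(\<lambda>p. indicator (side S i (fst p)) (snd p) :: ennreal) \<in> borel_measurable (borel \<Otimes>\<^sub>M \<mu>)"
    using measurable_indicator_side[of S i] by (simp add: split_beta')
  have den: "(\<lambda>x. \<integral>\<^sup>+t. indicator (side S i x) t \<partial>\<mu>) \<in> borel_measurable borel"
    using e by (intro borel_measurable_nn_integral) (simp add: split_beta')
  have num: "(\<lambda>x. \<integral>\<^sup>+t. ennreal \<bar>x - t\<bar> * indicator (side S i x) t \<partial>\<mu>) \<in> borel_measurable borel"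
    using e by (intro borel_measurable_nn_integral) (simp add: split_beta')
  show ?thesis unfolding mean_dist_def 1 by (rule borel_measurable_divide_ennreal[OF num den])
qed

lemma
  assumes "prob_space \<mu>" "sets \<mu> = sets borel"
  shows measurable_mean_dist_below: "(\<lambda>x. mean_dist \<mu> {..<x} x) \<in> borel_measurable borel"
    and measurable_mean_dist_above: "(\<lambda>x. mean_dist \<mu> {x<..} x) \<in> borel_measurable borel"
  using measurable_mean_dist[OF assms, of "{0}" 0] measurable_mean_dist[OF assms, of "{}" 0]
  by (simp_all add: side_def)

text \<open>On the event that the ranks are given by \<open>(r, S)\<close>, the distance of \<open>X\<^sub>r\<close> to the \<open>j\<close>-th
  observation may be replaced by its mean over the half-line to which that event confines the \<open>j\<close>-th
  observation. After conditioning on \<open>X\<^sub>r\<close>, only the factor with index \<open>j\<close> differs between the two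
  sides, and for that factor the claim is \<open>mean_dist_times\<close>.\<close>
lemma (in prob_space) nn_integral_rank_event:
  fixes Xs :: "nat \<Rightarrow> 'a \<Rightarrow> real" and h :: "real \<Rightarrow> ennreal"
  assumes I: "finite I" "r \<in> I" "j \<in> I - {r}" and indep: "indep_vars (\<lambda>_. borel) Xs I"
    and distr: "\<And>i. i \<in> I \<Longrightarrow> distr M borel (Xs i) = \<mu>"
    and h [measurable]: "h \<in> borel_measurable borel"
  shows "(\<integral>\<^sup>+\<omega>. h (Xs r \<omega>) * ennreal \<bar>Xs r \<omega> - Xs j \<omega>\<bar> * rank_event I r S (\<lambda>i. Xs i \<omega>) \<partial>M) =
    (\<integral>\<^sup>+\<omega>. h (Xs r \<omega>) * mean_dist \<mu> (side S j (Xs r \<omega>)) (Xs r \<omega>) * rank_event I r S (\<lambda>i. Xs i \<omega>) \<partial>M)"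
proof -
  have rv [measurable]: "random_variable borel (Xs i)" if "i \<in> I" for i
    using indep that unfolding indep_vars_def by auto
  have \<mu>: "prob_space \<mu>" "sets \<mu> = sets borel"
    using distr[OF I(2)] rv[OF I(2)] prob_space_distr by auto
  interpret \<mu>: prob_space \<mu> by fact
  note measurable_indicator_side[measurable] \<mu>(2)[measurable_cong]
  let ?J = "I - {r}" let ?K = "I - {r} - {j}"
  let ?e = "\<lambda>i x t. indicator (side S i x) t :: ennreal"
  let ?f = "\<lambda>i x t. (if i = j then ennreal \<bar>x - t\<bar> else 1) * ?e i x t"
  have split: "(\<Prod>i\<in>?J. g i) = g j * (\<Prod>i\<in>?K. g i)" for g :: "nat \<Rightarrow> ennreal"
    using I by (intro prod.remove) auto
  have int_e: "(\<integral>\<^sup>+t. ?e i x t \<partial>\<mu>) = emeasure \<mu> (side S i x)" for i x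
    by (simp add: \<mu>(2) side_def)
  have m: "case_prod (?f i) \<in> borel_measurable (borel \<Otimes>\<^sub>M borel)" for i
    by (cases "i = j") (simp_all add: split_beta' measurable_indicator_side[unfolded split_beta'])
  have m': "(\<lambda>x. h x * mean_dist \<mu> (side S j x) x) \<in> borel_measurable borel"
    using measurable_mean_dist[OF \<mu>] by simp
  have "(\<integral>\<^sup>+\<omega>. h (Xs r \<omega>) * ennreal \<bar>Xs r \<omega> - Xs j \<omega>\<bar> * rank_event I r S (\<lambda>i. Xs i \<omega>) \<partial>M) =
    (\<integral>\<^sup>+\<omega>. h (Xs r \<omega>) * (\<Prod>i\<in>?J. ?f i (Xs r \<omega>) (Xs i \<omega>)) \<partial>M)"
    unfolding rank_event_def split by (intro nn_integral_cong) (simp add: mult_ac)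
  also have "\<dots> = (\<integral>\<^sup>+x. h x * (\<Prod>i\<in>?J. \<integral>\<^sup>+t. ?f i x t \<partial>\<mu>) \<partial>\<mu>)"
    by (intro nn_integral_iid_conditioning I indep distr h m)
  also have "\<dots> = (\<integral>\<^sup>+x. (h x * mean_dist \<mu> (side S j x) x) * (\<Prod>i\<in>?J. \<integral>\<^sup>+t. ?e i x t \<partial>\<mu>) \<partial>\<mu>)"
  proof (intro nn_integral_cong)
    fix x
    have eq: "(\<integral>\<^sup>+t. ?f j x t \<partial>\<mu>) = mean_dist \<mu> (side S j x) x * (\<integral>\<^sup>+t. ?e j x t \<partial>\<mu>)"
      unfolding int_e using \<mu>
      by (subst mean_dist_times) (auto simp: side_def \<mu>.finite_measure_axioms)
    have "(\<Prod>i\<in>?K. \<integral>\<^sup>+t. ?f i x t \<partial>\<mu>) = (\<Prod>i\<in>?K. \<integral>\<^sup>+t. ?e i x t \<partial>\<mu>)"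
      by (intro prod.cong) auto
    then show "h x * (\<Prod>i\<in>?J. \<integral>\<^sup>+t. ?f i x t \<partial>\<mu>) =
        (h x * mean_dist \<mu> (side S j x) x) * (\<Prod>i\<in>?J. \<integral>\<^sup>+t. ?e i x t \<partial>\<mu>)"
      unfolding split eq by (simp only: mult.assoc)
  qed
  also have "\<dots> = (\<integral>\<^sup>+\<omega>. (h (Xs r \<omega>) * mean_dist \<mu> (side S j (Xs r \<omega>)) (Xs r \<omega>)) *
      (\<Prod>i\<in>?J. ?e i (Xs r \<omega>) (Xs i \<omega>)) \<partial>M)"
    by (rule nn_integral_iid_conditioning[OF I(1,2) indep distr m' measurable_indicator_side, symmetric])
  finally show ?thesis by (simp add: rank_event_def)
qed

text \<open>Conditionally on \<open>X\<^sub>r = x\<close>, the event of a tie has probability \<open>\<mu> {x}\<close>.\<close>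
lemma (in prob_space) AE_iid_neq:
  fixes Xs :: "nat \<Rightarrow> 'a \<Rightarrow> real"
  assumes I: "finite I" "r \<in> I" "j \<in> I" "r \<noteq> j" and indep: "indep_vars (\<lambda>_. borel) Xs I"
    and distr: "\<And>i. i \<in> I \<Longrightarrow> distr M borel (Xs i) = \<mu>"
    and nonatomic: "\<And>x. emeasure \<mu> {x} = 0"
  shows "AE \<omega> in M. Xs r \<omega> \<noteq> Xs j \<omega>"
proof -
  have rv [measurable]: "random_variable borel (Xs i)" if "i \<in> I" for i
    using indep that unfolding indep_vars_def by auto
  have \<mu>: "sets \<mu> = sets borel" using distr[OF I(2)] by auto
  let ?f = "\<lambda>i (x::real) t. if i = j then indicator {x} t else 1 :: ennreal"
  have m: "case_prod (?f i) \<in> borel_measurable (borel \<Otimes>\<^sub>M borel)" for i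
  proof -
    have eq: "case_prod (?f i) =
        (\<lambda>p. if i = j then if fst p < snd p then 0 else if snd p < fst p then 0 else 1 else 1)"
      by (auto simp: fun_eq_iff indicator_def)
    show ?thesis unfolding eq by (cases "i = j") simp_all
  qed
  have split: "(\<Prod>i\<in>I - {r}. g i) = g j * (\<Prod>i\<in>I - {r} - {j}. g i)" for g :: "nat \<Rightarrow> ennreal"
    using I by (intro prod.remove) auto
  have "(\<integral>\<^sup>+\<omega>. indicator {Xs r \<omega>} (Xs j \<omega>) \<partial>M) =
      (\<integral>\<^sup>+\<omega>. 1 * (\<Prod>i\<in>I - {r}. ?f i (Xs r \<omega>) (Xs i \<omega>)) \<partial>M)"
    unfolding split by (intro nn_integral_cong) simp
  also have "\<dots> = (\<integral>\<^sup>+x. 1 * (\<Prod>i\<in>I - {r}. \<integral>\<^sup>+t. ?f i x t \<partial>\<mu>) \<partial>\<mu>)"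
    by (rule nn_integral_iid_conditioning[where h="\<lambda>_. 1" and f="?f", OF I(1,2) indep distr _ m]) simp_all
  also have "\<dots> = 0"
    unfolding split using nonatomic by (simp add: \<mu>)
  finally have "(\<integral>\<^sup>+\<omega>. indicator {Xs r \<omega>} (Xs j \<omega>) \<partial>M) = (0::ennreal)" .
  moreover have "(\<lambda>\<omega>. indicator {Xs r \<omega>} (Xs j \<omega>) :: ennreal) = (\<lambda>\<omega>. if Xs j \<omega> = Xs r \<omega> then 1 else 0)"
    by (auto simp: fun_eq_iff)
  ultimately have "(\<integral>\<^sup>+\<omega>. (if Xs j \<omega> = Xs r \<omega> then 1 else 0) \<partial>M) = (0::ennreal)" by simp
  then have "AE \<omega> in M. (if Xs j \<omega> = Xs r \<omega> then 1 else 0 :: ennreal) = 0"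
    using rv[OF I(2)] rv[OF I(3)] by (subst (asm) nn_integral_0_iff_AE) auto
  then show ?thesis by eventually_elim (auto split: if_splits)
qed

section \<open>Conditional expectations given an order statistic\<close>

lemma measurable_rank_event:
  assumes "finite I" "r \<in> I" and rv: "\<And>i. i \<in> I \<Longrightarrow> X i \<in> borel_measurable M"
  shows "(\<lambda>\<omega>. rank_event I r S (\<lambda>i. X i \<omega>)) \<in> borel_measurable M"
  unfolding rank_event_def
proof (intro borel_measurable_prod_ennreal)
  fix i assume "i \<in> I - {r}"
  then have "(\<lambda>\<omega>. (X r \<omega>, X i \<omega>)) \<in> measurable M (borel \<Otimes>\<^sub>M borel)"
    using assms by (intro measurable_Pair) auto
  from measurable_compose[OF this measurable_indicator_side]
  show "(\<lambda>\<omega>. indicator (side S i (X r \<omega>)) (X i \<omega>) :: ennreal) \<in> borel_measurable M" by simp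
qed

text \<open>An independent sample of size \<open>n\<close> from an atomless law.\<close>
locale iid_sample = prob_space +
  fixes Xs :: "nat \<Rightarrow> 'a \<Rightarrow> real" and n :: nat and \<mu> :: "real measure"
  assumes indep: "indep_vars (\<lambda>_. borel) Xs {1..n}"
    and distr_Xs: "\<And>i. i \<in> {1..n} \<Longrightarrow> distr M borel (Xs i) = \<mu>"
    and nonatomic: "\<And>x. emeasure \<mu> {x} = 0"
    and law: "real_distribution \<mu>"
begin

sublocale \<mu>: real_distribution \<mu> by (rule law)

lemma measurable_Xs: "i \<in> {1..n} \<Longrightarrow> Xs i \<in> borel_measurable M"
  using indep unfolding indep_vars_def by auto

lemma AE_distinct_sample: "AE \<omega> in M. inj_on (\<lambda>i. Xs i \<omega>) {1..n}"
proof -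
  have "AE \<omega> in M. \<forall>i\<in>{1..n}. \<forall>j\<in>{1..n}. i \<noteq> j \<longrightarrow> Xs i \<omega> \<noteq> Xs j \<omega>"
  proof (intro AE_finite_allI finite_atLeastAtMost)
    fix i j assume ij: "i \<in> {1..n}" "j \<in> {1..n}"
    show "AE \<omega> in M. i \<noteq> j \<longrightarrow> Xs i \<omega> \<noteq> Xs j \<omega>"
    proof (cases "i = j")
      case False
      then have "AE \<omega> in M. Xs i \<omega> \<noteq> Xs j \<omega>"
        using ij by (intro AE_iid_neq[OF _ _ _ _ indep distr_Xs nonatomic]) auto
      then show ?thesis by eventually_elim simp
    qed simp
  qed
  then show ?thesis by eventually_elim (auto simp: inj_on_def)
qed

text \<open>In the applications \<open>D r S\<close> is either \<open>S\<close> or the set of remaining indices, and \<open>A x\<close> is the corresponding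
  half-line at \<open>x\<close>; treating them as parameters covers lower and upper gaps at once. Split the
  expectation according to the pair that describes the ranks, replace each of the \<open>c\<close> distances by its
  mean on every piece, and add the pieces up again.\<close>
lemma nn_integral_order_stat_gaps:
  fixes h :: "real \<Rightarrow> ennreal" and D :: "nat \<Rightarrow> nat set \<Rightarrow> nat set" and A :: "real \<Rightarrow> real set"
  assumes k: "1 \<le> k" "k \<le> n" and h: "h \<in> borel_measurable borel"
    and D: "\<And>r S. (r, S) \<in> rank_pairs n k \<Longrightarrow> D r S \<subseteq> {1..n} - {r} \<and> card (D r S) = c"
    and A: "\<And>r S j. (r, S) \<in> rank_pairs n k \<Longrightarrow> j \<in> D r S \<Longrightarrow> side S j = A"
    and A_meas: "(\<lambda>x. mean_dist \<mu> (A x) x) \<in> borel_measurable borel"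
    and Y: "\<And>\<omega> r S. inj_on (\<lambda>i. Xs i \<omega>) {1..n} \<Longrightarrow> (r, S) \<in> rank_pairs n k \<Longrightarrow>
      rank_event {1..n} r S (\<lambda>i. Xs i \<omega>) \<noteq> 0 \<Longrightarrow> Y \<omega> = (\<Sum>j\<in>D r S. \<bar>Xs r \<omega> - Xs j \<omega>\<bar>)"
  defines "Z \<equiv> order_stat Xs n k"
  shows "(\<integral>\<^sup>+\<omega>. h (Z \<omega>) * ennreal (Y \<omega>) \<partial>M) =
    of_nat c * (\<integral>\<^sup>+\<omega>. h (Z \<omega>) * mean_dist \<mu> (A (Z \<omega>)) (Z \<omega>) \<partial>M)"
proof -
  let ?re = "\<lambda>r S \<omega>. rank_event {1..n} r S (\<lambda>i. Xs i \<omega>)"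
  let ?P = "rank_pairs n k"
  let ?v = "\<lambda>x. mean_dist \<mu> (A x) x"
  have fin: "finite ?P" by (auto simp: rank_pairs_def)
  have P: "r \<in> {1..n}" "D r S \<subseteq> {1..n} - {r}" "finite (D r S)" if "(r, S) \<in> ?P" for r S
    using that D[OF that] finite_subset[of "D r S" "{1..n}"] by (auto simp: rank_pairs_def)
  have m_re: "(\<lambda>\<omega>. ?re r S \<omega>) \<in> borel_measurable M" if "r \<in> {1..n}" for r S
    using that measurable_Xs by (intro measurable_rank_event) auto
  have m_h: "(\<lambda>\<omega>. h (Xs r \<omega>)) \<in> borel_measurable M" "(\<lambda>\<omega>. ?v (Xs r \<omega>)) \<in> borel_measurable M"
    if "r \<in> {1..n}" for r
    using measurable_compose[OF measurable_Xs[OF that] h]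
      measurable_compose[OF measurable_Xs[OF that] A_meas] by auto
  have m_term: "(\<lambda>\<omega>. h (Xs r \<omega>) * ennreal \<bar>Xs r \<omega> - Xs j \<omega>\<bar> * ?re r S \<omega>) \<in> borel_measurable M"
    if "(r, S) \<in> ?P" "j \<in> D r S" for r S j
  proof -
    note [measurable] = measurable_Xs[of r] measurable_Xs[of j] m_re[of r S] m_h[of r]
    have "r \<in> {1..n}" "j \<in> {1..n}" using P[OF that(1)] that by auto
    then show ?thesis by measurable
  qed
  have "(\<integral>\<^sup>+\<omega>. h (Z \<omega>) * ennreal (Y \<omega>) \<partial>M) =
      (\<integral>\<^sup>+\<omega>. (\<Sum>(r, S)\<in>?P. \<Sum>j\<in>D r S. h (Xs r \<omega>) * ennreal \<bar>Xs r \<omega> - Xs j \<omega>\<bar> * ?re r S \<omega>) \<partial>M)"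
  proof (rule nn_integral_cong_AE)
    show "AE \<omega> in M. h (Z \<omega>) * ennreal (Y \<omega>) =
      (\<Sum>(r, S)\<in>?P. \<Sum>j\<in>D r S. h (Xs r \<omega>) * ennreal \<bar>Xs r \<omega> - Xs j \<omega>\<bar> * ?re r S \<omega>)"
      using AE_distinct_sample
    proof eventually_elim
      case (elim \<omega>)
      have "h (Z \<omega>) * ennreal (Y \<omega>) = h (Z \<omega>) * ennreal (Y \<omega>) * (\<Sum>(r, S)\<in>?P. ?re r S \<omega>)"
        using sum_rank_events[where X=Xs and \<omega>=\<omega>, OF k elim] by simp
      also have "\<dots> = (\<Sum>(r, S)\<in>?P. h (Z \<omega>) * ennreal (Y \<omega>) * ?re r S \<omega>)"
        by (simp add: sum_distrib_left split_beta')
      also have "\<dots> = (\<Sum>(r, S)\<in>?P. \<Sum>j\<in>D r S. h (Xs r \<omega>) * ennreal \<bar>Xs r \<omega> - Xs j \<omega>\<bar> * ?re r S \<omega>)"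
      proof (intro sum.cong refl, clarify)
        fix r S assume p: "(r, S) \<in> ?P"
        show "h (Z \<omega>) * ennreal (Y \<omega>) * ?re r S \<omega> =
          (\<Sum>j\<in>D r S. h (Xs r \<omega>) * ennreal \<bar>Xs r \<omega> - Xs j \<omega>\<bar> * ?re r S \<omega>)"
        proof (cases "?re r S \<omega> = 0")
          case False
          have "Z \<omega> = Xs r \<omega>"
            unfolding Z_def by (rule rank_event_order_stat(1)[where X=Xs and \<omega>=\<omega>, OF k elim p False])
          moreover have "ennreal (Y \<omega>) = (\<Sum>j\<in>D r S. ennreal \<bar>Xs r \<omega> - Xs j \<omega>\<bar>)"
            using Y[OF elim p False] by simp
          ultimately show ?thesis by (simp add: sum_distrib_left sum_distrib_right del: sum_ennreal)
        qed simp
      qed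
      finally show ?case .
    qed
  qed
  also have "\<dots> = (\<Sum>(r, S)\<in>?P. \<Sum>j\<in>D r S. \<integral>\<^sup>+\<omega>. h (Xs r \<omega>) * ennreal \<bar>Xs r \<omega> - Xs j \<omega>\<bar> * ?re r S \<omega> \<partial>M)"
    using m_term unfolding split_beta'
    by (subst nn_integral_sum; (intro sum.cong refl nn_integral_sum borel_measurable_sum)?) auto
  also have "\<dots> = (\<Sum>(r, S)\<in>?P. \<Sum>j\<in>D r S. \<integral>\<^sup>+\<omega>. h (Xs r \<omega>) * ?v (Xs r \<omega>) * ?re r S \<omega> \<partial>M)"
  proof (intro sum.cong refl, clarify, intro sum.cong refl)
    fix r S j assume p: "(r, S) \<in> ?P" and j: "j \<in> D r S"
    then have "r \<in> {1..n}" "j \<in> {1..n} - {r}" using P[OF p] by auto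
    from nn_integral_rank_event[OF _ this indep distr_Xs h, of S] A[OF p j]
    show "(\<integral>\<^sup>+\<omega>. h (Xs r \<omega>) * ennreal \<bar>Xs r \<omega> - Xs j \<omega>\<bar> * ?re r S \<omega> \<partial>M) =
      (\<integral>\<^sup>+\<omega>. h (Xs r \<omega>) * ?v (Xs r \<omega>) * ?re r S \<omega> \<partial>M)" by simp
  qed
  also have "\<dots> = (\<Sum>(r, S)\<in>?P. of_nat c * (\<integral>\<^sup>+\<omega>. h (Xs r \<omega>) * ?v (Xs r \<omega>) * ?re r S \<omega> \<partial>M))"
    using D by (intro sum.cong) auto
  also have "\<dots> = of_nat c * (\<Sum>(r, S)\<in>?P. \<integral>\<^sup>+\<omega>. h (Xs r \<omega>) * ?v (Xs r \<omega>) * ?re r S \<omega> \<partial>M)"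
    by (simp add: sum_distrib_left split_beta')
  also have "(\<Sum>(r, S)\<in>?P. \<integral>\<^sup>+\<omega>. h (Xs r \<omega>) * ?v (Xs r \<omega>) * ?re r S \<omega> \<partial>M) =
      (\<integral>\<^sup>+\<omega>. (\<Sum>(r, S)\<in>?P. h (Xs r \<omega>) * ?v (Xs r \<omega>) * ?re r S \<omega>) \<partial>M)"
    unfolding split_beta'
    by (subst nn_integral_sum) (use P(1) m_re m_h in \<open>auto intro!: borel_measurable_times_ennreal\<close>)
  also have "\<dots> = (\<integral>\<^sup>+\<omega>. h (Z \<omega>) * ?v (Z \<omega>) \<partial>M)"
  proof (rule nn_integral_cong_AE)
    show "AE \<omega> in M. (\<Sum>(r, S)\<in>?P. h (Xs r \<omega>) * ?v (Xs r \<omega>) * ?re r S \<omega>) = h (Z \<omega>) * ?v (Z \<omega>)"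
      using AE_distinct_sample
    proof eventually_elim
      case (elim \<omega>)
      have "(\<Sum>(r, S)\<in>?P. h (Xs r \<omega>) * ?v (Xs r \<omega>) * ?re r S \<omega>) =
          (\<Sum>(r, S)\<in>?P. h (Z \<omega>) * ?v (Z \<omega>) * ?re r S \<omega>)"
      proof (intro sum.cong refl, clarify)
        fix r S assume p: "(r, S) \<in> ?P"
        show "h (Xs r \<omega>) * ?v (Xs r \<omega>) * ?re r S \<omega> = h (Z \<omega>) * ?v (Z \<omega>) * ?re r S \<omega>"
        proof (cases "?re r S \<omega> = 0")
          case False
          have "Z \<omega> = Xs r \<omega>"
            unfolding Z_def by (rule rank_event_order_stat(1)[where X=Xs and \<omega>=\<omega>, OF k elim p False])
          then show ?thesis by simp
        qed simp
      qed
      also have "\<dots> = h (Z \<omega>) * ?v (Z \<omega>) * (\<Sum>(r, S)\<in>?P. ?re r S \<omega>)"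
        by (simp add: sum_distrib_left split_beta')
      finally show ?case using sum_rank_events[where X=Xs and \<omega>=\<omega>, OF k elim] by simp
    qed
  qed
  finally show ?thesis .
qed

end

text \<open>For a nonnegative variable the defining property of a conditional expectation can be tested with
  extended nonnegative integrals over the events \<open>Z \<in> B\<close>; the value may be infinite on both sides.\<close>
lemma (in prob_space) AE_cond_exp_at_eq:
  fixes Y Z :: "'a \<Rightarrow> real" and v :: "real \<Rightarrow> ennreal"
  assumes [measurable]: "Y \<in> borel_measurable M" "Z \<in> borel_measurable M" "v \<in> borel_measurable borel"
    and nonneg: "\<And>\<omega>. Y \<omega> \<ge> 0"
    and int: "\<And>B. B \<in> sets borel \<Longrightarrow>
      (\<integral>\<^sup>+\<omega>. indicator B (Z \<omega>) * ennreal (Y \<omega>) \<partial>M) = (\<integral>\<^sup>+\<omega>. indicator B (Z \<omega>) * v (Z \<omega>) \<partial>M)"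
  shows "AE x in distr M borel Z. cond_exp_at M Y Z x = enn2real (v x)"
proof -
  let ?F = "vimage_algebra (space M) Z borel"
  have sub: "subalgebra M ?F"
    by (auto simp: subalgebra_def sets_vimage_algebra2)
  interpret finite_measure_subalgebra M ?F
    by standard (rule sub)
  have Z: "Z \<in> measurable ?F borel" by (rule measurable_vimage_algebra1) simp
  have "AE \<omega> in M. v (Z \<omega>) = nn_cond_exp M ?F (\<lambda>\<omega>. ennreal (Y \<omega>)) \<omega>"
  proof (rule nn_cond_exp_charact)
    fix A assume "A \<in> sets ?F"
    then obtain B where B: "B \<in> sets borel" "A = Z -` B \<inter> space M"
      by (auto simp: sets_vimage_algebra2)
    have ind: "indicator A \<omega> = (indicator B (Z \<omega>) :: ennreal)" if "\<omega> \<in> space M" for \<omega>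
      using B that by (auto simp: indicator_def)
    have "(\<integral>\<^sup>+\<omega>\<in>A. ennreal (Y \<omega>) \<partial>M) = (\<integral>\<^sup>+\<omega>. indicator B (Z \<omega>) * ennreal (Y \<omega>) \<partial>M)"
      by (intro nn_integral_cong) (simp add: ind mult.commute)
    also have "\<dots> = (\<integral>\<^sup>+\<omega>. indicator B (Z \<omega>) * v (Z \<omega>) \<partial>M)" by (rule int[OF B(1)])
    also have "\<dots> = (\<integral>\<^sup>+\<omega>\<in>A. v (Z \<omega>) \<partial>M)"
      by (intro nn_integral_cong) (simp add: ind mult.commute)
    finally show "(\<integral>\<^sup>+\<omega>\<in>A. ennreal (Y \<omega>) \<partial>M) = (\<integral>\<^sup>+\<omega>\<in>A. v (Z \<omega>) \<partial>M)" .
  next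
    show "(\<lambda>\<omega>. v (Z \<omega>)) \<in> borel_measurable ?F" using measurable_compose[OF Z assms(3)] .
  qed simp
  moreover have "AE \<omega> in M. 0 = nn_cond_exp M ?F (\<lambda>\<omega>. ennreal (- Y \<omega>)) \<omega>"
    using nonneg by (intro nn_cond_exp_charact) (auto simp: ennreal_neg)
  moreover note AE_cond_exp_at[of M Y Z]
  ultimately have "AE \<omega> in M. cond_exp_at M Y Z (Z \<omega>) = enn2real (v (Z \<omega>))"
    by eventually_elim (simp add: real_cond_exp_def)
  then show ?thesis
    using borel_measurable_cond_exp_at[of M Y Z] by (subst AE_distr_iff) auto
qed

context iid_sample
begin

lemma AE_cond_exp_order_stat_gaps:
  fixes D :: "nat \<Rightarrow> nat set \<Rightarrow> nat set" and A :: "real \<Rightarrow> real set"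
  assumes k: "1 \<le> k" "k \<le> n" and c: "c > 0"
    and D: "\<And>r S. (r, S) \<in> rank_pairs n k \<Longrightarrow> D r S \<subseteq> {1..n} - {r} \<and> card (D r S) = c"
    and A: "\<And>r S j. (r, S) \<in> rank_pairs n k \<Longrightarrow> j \<in> D r S \<Longrightarrow> side S j = A"
    and A_meas: "(\<lambda>x. mean_dist \<mu> (A x) x) \<in> borel_measurable borel"
    and Y: "\<And>\<omega> r S. inj_on (\<lambda>i. Xs i \<omega>) {1..n} \<Longrightarrow> (r, S) \<in> rank_pairs n k \<Longrightarrow>
      rank_event {1..n} r S (\<lambda>i. Xs i \<omega>) \<noteq> 0 \<Longrightarrow> Y \<omega> = (\<Sum>j\<in>D r S. \<bar>Xs r \<omega> - Xs j \<omega>\<bar>)"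
    and Y_meas: "Y \<in> borel_measurable M" and Y_nonneg: "\<And>\<omega>. Y \<omega> \<ge> 0"
  shows "AE x in distr M borel (order_stat Xs n k).
    cond_exp_at M (\<lambda>\<omega>. 1 / real c * Y \<omega>) (order_stat Xs n k) x = enn2real (mean_dist \<mu> (A x) x)"
proof (rule AE_cond_exp_at_eq)
  let ?Z = "order_stat Xs n k"
  show Z: "?Z \<in> borel_measurable M" using k measurable_Xs by (intro measurable_order_stat) auto
  show "(\<lambda>\<omega>. 1 / real c * Y \<omega>) \<in> borel_measurable M" using Y_meas by simp
  show "1 / real c * Y \<omega> \<ge> 0" for \<omega> using Y_nonneg by simp
  fix B :: "real set" assume [measurable]: "B \<in> sets borel"
  note [measurable] = Z Y_meas
  have "(\<integral>\<^sup>+\<omega>. indicator B (?Z \<omega>) * ennreal (1 / real c * Y \<omega>) \<partial>M) =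
    (\<integral>\<^sup>+\<omega>. ennreal (1 / real c) * (indicator B (?Z \<omega>) * ennreal (Y \<omega>)) \<partial>M)"
    by (intro nn_integral_cong, subst ennreal_mult) (simp_all only: mult_ac Y_nonneg zero_le_divide_1_iff of_nat_0_le_iff)
  also have "\<dots> = ennreal (1 / real c) * (\<integral>\<^sup>+\<omega>. indicator B (?Z \<omega>) * ennreal (Y \<omega>) \<partial>M)"
    by (intro nn_integral_cmult) measurable
  also have "(\<integral>\<^sup>+\<omega>. indicator B (?Z \<omega>) * ennreal (Y \<omega>) \<partial>M) =
      of_nat c * (\<integral>\<^sup>+\<omega>. indicator B (?Z \<omega>) * mean_dist \<mu> (A (?Z \<omega>)) (?Z \<omega>) \<partial>M)"
    by (rule nn_integral_order_stat_gaps[where D=D and A=A, OF k])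
      (simp, erule D, erule (1) A, rule A_meas, erule (2) Y)
  also have "ennreal (1 / real c) * (of_nat c * (\<integral>\<^sup>+\<omega>. indicator B (?Z \<omega>) * mean_dist \<mu> (A (?Z \<omega>)) (?Z \<omega>) \<partial>M)) =
     (\<integral>\<^sup>+\<omega>. indicator B (?Z \<omega>) * mean_dist \<mu> (A (?Z \<omega>)) (?Z \<omega>) \<partial>M)"
  proof -
    have "ennreal (1 / real c) * of_nat c = 1"
      using c by (simp add: ennreal_of_nat_eq_real_of_nat flip: ennreal_mult)
    then show ?thesis by (simp add: mult.assoc[symmetric])
  qed
  finally show "(\<integral>\<^sup>+\<omega>. indicator B (?Z \<omega>) * ennreal (1 / real c * Y \<omega>) \<partial>M) =
    (\<integral>\<^sup>+\<omega>. indicator B (?Z \<omega>) * mean_dist \<mu> (A (?Z \<omega>)) (?Z \<omega>) \<partial>M)" .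
qed (rule A_meas)

lemma
  assumes k: "2 \<le> k" "k \<le> n - 1"
  shows AE_cond_exp_lower_gaps: "AE x in distr M borel (order_stat Xs n k).
      cond_exp_at M (\<lambda>\<omega>. 1 / real (k - 1) * (\<Sum>i=1..k-1. order_stat Xs n k \<omega> - order_stat Xs n i \<omega>))
        (order_stat Xs n k) x = enn2real (mean_dist \<mu> {..<x} x)"
    and AE_cond_exp_upper_gaps: "AE x in distr M borel (order_stat Xs n k).
      cond_exp_at M (\<lambda>\<omega>. 1 / real (n - k) * (\<Sum>j=k+1..n. order_stat Xs n j \<omega> - order_stat Xs n k \<omega>))
        (order_stat Xs n k) x = enn2real (mean_dist \<mu> {x<..} x)"
proof -
  have k': "1 \<le> k" "k \<le> n" using k by auto
  have m: "order_stat Xs n i \<in> borel_measurable M" if "i \<in> {1..n}" for i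
    using that measurable_Xs by (intro measurable_order_stat) auto
  have md: "(\<lambda>x. mean_dist \<mu> {..<x} x) \<in> borel_measurable borel"
    "(\<lambda>x. mean_dist \<mu> {x<..} x) \<in> borel_measurable borel"
    by (intro measurable_mean_dist_below measurable_mean_dist_above \<mu>.prob_space_axioms \<mu>.events_eq_borel)+
  have card: "card ({1..n} - {r} - S) = n - k" if "(r, S) \<in> rank_pairs n k" for r S
  proof -
    have *: "S \<subseteq> {1..n} - {r}" "card S = k - 1" "r \<in> {1..n}" using that by (auto simp: rank_pairs_def)
    moreover have "finite S" using *(1) finite_subset by blast
    ultimately show ?thesis using k by (simp add: card_Diff_subset)
  qed
  show "AE x in distr M borel (order_stat Xs n k).
      cond_exp_at M (\<lambda>\<omega>. 1 / real (k - 1) * (\<Sum>i=1..k-1. order_stat Xs n k \<omega> - order_stat Xs n i \<omega>))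
        (order_stat Xs n k) x = enn2real (mean_dist \<mu> {..<x} x)"
  proof (rule AE_cond_exp_order_stat_gaps[where D="\<lambda>r S. S", OF k'])
    show "0 < k - 1" using k by simp
    show "side S j = lessThan" if "j \<in> S" for S j using that by (auto simp: side_def)
    show "(\<lambda>\<omega>. \<Sum>i=1..k-1. order_stat Xs n k \<omega> - order_stat Xs n i \<omega>) \<in> borel_measurable M"
      using k by (intro borel_measurable_sum borel_measurable_diff m) auto
    show "(\<Sum>i=1..k-1. order_stat Xs n k \<omega> - order_stat Xs n i \<omega>) \<ge> 0" for \<omega>
      using k order_stat_mono[of _ k n Xs \<omega>] by (intro sum_nonneg) auto
    show "S \<subseteq> {1..n} - {r} \<and> card S = k - 1" if "(r, S) \<in> rank_pairs n k" for r S
      using that by (simp add: rank_pairs_def)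
  qed (rule md | erule (2) rank_event_order_stat(2)[where X=Xs, OF k'])+
  show "AE x in distr M borel (order_stat Xs n k).
      cond_exp_at M (\<lambda>\<omega>. 1 / real (n - k) * (\<Sum>j=k+1..n. order_stat Xs n j \<omega> - order_stat Xs n k \<omega>))
        (order_stat Xs n k) x = enn2real (mean_dist \<mu> {x<..} x)"
  proof (rule AE_cond_exp_order_stat_gaps[where D="\<lambda>r S. {1..n} - {r} - S", OF k'])
    show "0 < n - k" using k by simp
    show "side S j = greaterThan" if "j \<in> {1..n} - {r} - S" for S r j using that by (auto simp: side_def)
    show "(\<lambda>\<omega>. \<Sum>j=k+1..n. order_stat Xs n j \<omega> - order_stat Xs n k \<omega>) \<in> borel_measurable M"
      using k by (intro borel_measurable_sum borel_measurable_diff m) auto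
    show "(\<Sum>j=k+1..n. order_stat Xs n j \<omega> - order_stat Xs n k \<omega>) \<ge> 0" for \<omega>
      using k order_stat_mono[of k _ n Xs \<omega>] by (intro sum_nonneg) auto
    show "{1..n} - {r} - S \<subseteq> {1..n} - {r} \<and> card ({1..n} - {r} - S) = n - k"
      if "(r, S) \<in> rank_pairs n k" for r S
      using card[OF that] by blast
  qed (rule md | erule (2) rank_event_order_stat(3)[where X=Xs, OF k'])+
qed

text \<open>The law of an order statistic has the density \<open>x \<mapsto> const * F(x)\<^sup>k\<^sup>-\<^sup>1 * (1 - F(x))\<^sup>n\<^sup>-\<^sup>k\<close> with respect
  to \<open>\<mu>\<close>, where \<open>F = cdf \<mu>\<close>, and under \<open>pos\<close> this is positive almost everywhere. It suffices to bound that law from below by the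
  contribution of one rank pair; the other direction holds because an order statistic is always one of
  the observations.\<close>
lemma AE_order_stat_iff:
  assumes k: "1 \<le> k" "k \<le> n" and P: "{x. P x} \<in> sets borel"
    and pos: "AE x in \<mu>. emeasure \<mu> {..<x} \<noteq> 0 \<and> emeasure \<mu> {x<..} \<noteq> 0"
  shows "(AE x in distr M borel (order_stat Xs n k). P x) \<longleftrightarrow> (AE x in \<mu>. P x)"
proof -
  let ?Z = "order_stat Xs n k"
  have Z: "?Z \<in> borel_measurable M" using k measurable_Xs by (intro measurable_order_stat) auto
  have AE_distr: "(AE x in distr M borel Y. P x) \<longleftrightarrow> (AE \<omega> in M. P (Y \<omega>))"
    if "Y \<in> borel_measurable M" for Y
    using that P by (intro AE_distr_iff) auto
  have "AE x in \<mu>. P x" if *: "AE \<omega> in M. P (?Z \<omega>)"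
  proof -
    let ?h = "indicator {x. \<not> P x} :: real \<Rightarrow> ennreal"
    have h: "?h \<in> borel_measurable borel"
      using P by (intro borel_measurable_indicator) (simp add: Collect_neg_eq borel_comp)
    \<comment> \<open>Any pair would do; with \<open>r = 1\<close> the indices \<open>2, \<dots>, k\<close> are \<open>k - 1\<close> admissible ones.\<close>
    define S where "S = {2..k}"
    have pair: "(1, S) \<in> rank_pairs n k" using k by (auto simp: rank_pairs_def S_def)
    have one: "1 \<in> {1..n}" using k by simp
    have "(\<integral>\<^sup>+x. ?h x * (\<Prod>i\<in>{1..n} - {1}. \<integral>\<^sup>+t. indicator (side S i x) t \<partial>\<mu>) \<partial>\<mu>) =
      (\<integral>\<^sup>+\<omega>. ?h (Xs 1 \<omega>) * rank_event {1..n} 1 S (\<lambda>i. Xs i \<omega>) \<partial>M)"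
      unfolding rank_event_def
      by (rule nn_integral_iid_conditioning[OF _ one indep distr_Xs h measurable_indicator_side, symmetric]) simp
    also have "\<dots> = (\<integral>\<^sup>+\<omega>. 0 \<partial>M)"
    proof (rule nn_integral_cong_AE)
      show "AE \<omega> in M. ?h (Xs 1 \<omega>) * rank_event {1..n} 1 S (\<lambda>i. Xs i \<omega>) = 0"
        using * AE_distinct_sample
      proof eventually_elim
        case (elim \<omega>)
        show ?case
        proof (cases "rank_event {1..n} 1 S (\<lambda>i. Xs i \<omega>) = 0")
          case False
          have "?Z \<omega> = Xs 1 \<omega>"
            by (rule rank_event_order_stat(1)[where X=Xs and \<omega>=\<omega>, OF k elim(2) pair False])
          then show ?thesis using elim(1) by simp
        qed simp
      qed
    qed
    finally have int0: "(\<integral>\<^sup>+x. ?h x * (\<Prod>i\<in>{1..n} - {1}. \<integral>\<^sup>+t. indicator (side S i x) t \<partial>\<mu>) \<partial>\<mu>) = 0"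
      by simp
    have meas: "(\<lambda>x. ?h x * (\<Prod>i\<in>{1..n} - {1}. \<integral>\<^sup>+t. indicator (side S i x) t \<partial>\<mu>)) \<in> borel_measurable \<mu>"
    proof -
      have "(\<lambda>x. \<integral>\<^sup>+t. indicator (side S i x) t \<partial>\<mu>) \<in> borel_measurable borel" for i
        using measurable_indicator_side[of S i]
        by (intro \<mu>.borel_measurable_nn_integral) simp
      then show ?thesis
        using h by (intro borel_measurable_times_ennreal borel_measurable_prod_ennreal) simp_all
    qed
    have "AE x in \<mu>. ?h x * (\<Prod>i\<in>{1..n} - {1}. \<integral>\<^sup>+t. indicator (side S i x) t \<partial>\<mu>) = 0"
      using int0 nn_integral_0_iff_AE[OF meas] by simp
    then show ?thesis using pos
    proof eventually_elim
      case (elim x)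
      have "(\<integral>\<^sup>+t. indicator (side S i x) t \<partial>\<mu>) \<noteq> 0" for i
        using elim(2) by (simp add: side_def)
      then show ?case using elim(1) by (auto simp: indicator_def)
    qed
  qed
  moreover have "AE \<omega> in M. P (?Z \<omega>)" if *: "AE x in \<mu>. P x"
  proof -
    have "AE \<omega> in M. \<forall>i\<in>{1..n}. P (Xs i \<omega>)"
    proof (intro AE_finite_allI finite_atLeastAtMost)
      fix i assume i: "i \<in> {1..n}"
      then show "AE \<omega> in M. P (Xs i \<omega>)"
        using * AE_distr[OF measurable_Xs[OF i]] unfolding distr_Xs[OF i] by blast
    qed
    then show ?thesis
    proof eventually_elim
      case (elim \<omega>)
      then show ?case using order_stat_in_sample[OF k, of Xs \<omega>] by metis
    qed
  qed
  ultimately show ?thesis using AE_distr[OF Z] by blast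
qed

end

section \<open>The quantile function of an atomless law\<close>

lemma enn2real_divide_ennreal: "0 < p \<Longrightarrow> enn2real (a / ennreal p) = enn2real a / p"
  by (simp add: divide_ennreal_def enn2real_mult inverse_ennreal divide_inverse)

text \<open>The left-continuous generalized inverse of the distribution function. It exists for every law and
  becomes an exact right inverse when there are no atoms.\<close>
definition quantile :: "real measure \<Rightarrow> real \<Rightarrow> real" where
  "quantile \<mu> u = Inf {x. u \<le> cdf \<mu> x}"

locale nonatomic_law = real_distribution +
  assumes nonatomic: "\<And>x. measure M {x} = 0"
    and integrable_id: "integrable M (\<lambda>x. x)"
begin

sublocale cdf_distribution M by unfold_locales

abbreviation Q :: "real \<Rightarrow> real" where "Q \<equiv> quantile M"

lemma quantile_le_iff: "0 < u \<Longrightarrow> u < 1 \<Longrightarrow> Q u \<le> x \<longleftrightarrow> u \<le> cdf M x"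
  unfolding quantile_def using pseudoinverse[of u x] by simp

lemma distr_quantile: "distr (restrict_space lborel {0<..<1}) borel Q = M"
  using distr_I_eq_M by (simp add: quantile_def[abs_def])

lemma measurable_quantile: "Q \<in> borel_measurable (restrict_space lborel {0<..<1})"
  using measurable_CI by (simp add: quantile_def[abs_def] cong: measurable_cong_sets sets_restrict_space_cong)

text \<open>If \<open>cdf M (Q u) > u\<close>, continuity of the distribution function gives a point left of \<open>Q u\<close> where it
  still exceeds \<open>u\<close>,
  contradicting the minimality of \<open>Q u\<close>.\<close>
lemma cdf_quantile:
  assumes "0 < u" "u < 1"
  shows "cdf M (Q u) = u"
proof (rule antisym)
  show "cdf M (Q u) \<le> u"
  proof (rule ccontr)
    assume *: "\<not> cdf M (Q u) \<le> u"
    have "isCont (cdf M) (Q u)" using nonatomic isCont_cdf by blast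
    then have "(cdf M \<longlongrightarrow> cdf M (Q u)) (at_left (Q u))"
      by (auto simp: isCont_def intro: tendsto_within_subset)
    then have "eventually (\<lambda>x. u < cdf M x) (at_left (Q u))"
      using * by (intro order_tendstoD(1)) auto
    moreover have "eventually (\<lambda>x. x < Q u) (at_left (Q u))"
      by (simp add: eventually_at_filter)
    ultimately have "eventually (\<lambda>x. u < cdf M x \<and> x < Q u) (at_left (Q u))"
      by (rule eventually_conj)
    then obtain x where "u < cdf M x" "x < Q u"
      using eventually_happens'[OF trivial_limit_at_left_real] by blast
    then show False using quantile_le_iff[OF assms, of x] by simp
  qed
  show "u \<le> cdf M (Q u)" using quantile_le_iff[OF assms, of "Q u"] by simp
qed

lemma quantile_less_iff:
  assumes "0 < u" "u < 1" "0 < v" "v < 1"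
  shows "Q u < Q v \<longleftrightarrow> u < v"
  using quantile_le_iff[OF assms(3,4), of "Q u"] cdf_quantile[OF assms(1,2)] by auto

text \<open>\<open>M\<close> is the law of \<open>Q U\<close> for \<open>U\<close> uniform on \<open>(0,1)\<close>, so statements about \<open>M\<close> can be pulled back
  to the unit interval.\<close>
lemma AE_iff_AE_quantile:
  assumes "{x. P x} \<in> sets borel"
  shows "(AE x in M. P x) \<longleftrightarrow> (AE u in lborel. 0 < u \<and> u < 1 \<longrightarrow> P (Q u))"
proof -
  have "(AE x in M. P x) \<longleftrightarrow> (AE x in distr (restrict_space lborel {0<..<1}) borel Q. P x)"
    by (subst distr_quantile) (rule refl)
  also have "\<dots> \<longleftrightarrow> (AE u in restrict_space lborel {0<..<1}. P (Q u))"
    using assms by (intro AE_distr_iff measurable_quantile) auto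
  also have "\<dots> \<longleftrightarrow> (AE u in lborel. 0 < u \<and> u < 1 \<longrightarrow> P (Q u))"
    by (subst AE_restrict_space_iff) auto
  finally show ?thesis .
qed

lemma AE_cdf_interior: "AE x in M. 0 < cdf M x \<and> cdf M x < 1"
  by (subst AE_iff_AE_quantile) (auto simp: cdf_quantile intro!: AE_I2)

lemma set_integrable_quantile:
  assumes "S \<subseteq> {0<..<1}" "S \<in> sets borel"
  shows "set_integrable lborel S Q"
proof -
  have "integrable (distr (restrict_space lborel {0<..<1}) borel Q) (\<lambda>x. x)"
    using integrable_id by (subst distr_quantile)
  then have "integrable (restrict_space lborel {0<..<1}) Q"
    using measurable_quantile by (subst (asm) integrable_distr_eq) auto
  then have "set_integrable lborel {0<..<1} Q"
    by (subst (asm) integrable_restrict_space) (auto simp: set_integrable_def)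
  then show ?thesis by (rule set_integrable_subset) (use assms in auto)
qed

lemma quantile_integrable_on:
  assumes "0 \<le> a" "b \<le> 1"
  shows "Q integrable_on {a..b}"
proof -
  have "Q integrable_on {a<..<b}"
    using assms by (intro set_borel_integral_eq_integral set_integrable_quantile) auto
  then show ?thesis by (simp add: integrable_on_Icc_iff_Ioo)
qed

abbreviation G :: "real \<Rightarrow> real" where "G u \<equiv> integral {0..u} Q"

lemma G_diff:
  assumes "0 \<le> a" "a \<le> b" "b \<le> 1"
  shows "(LINT v:{a<..<b}|lborel. Q v) = G b - G a"
proof -
  have "set_integrable lborel {a<..<b} Q"
    using assms by (intro set_integrable_quantile) auto
  then have "(LINT v:{a<..<b}|lborel. Q v) = integral {a..b} Q"
    by (simp add: set_borel_integral_eq_integral(2) integral_open_interval_real)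
  moreover have "G a + integral {a..b} Q = G b"
    using assms by (intro Henstock_Kurzweil_Integration.integral_combine quantile_integrable_on) auto
  ultimately show ?thesis by simp
qed

text \<open>The substitution \<open>t = Q v\<close>. The set \<open>A\<close> is the half-line below or above \<open>Q u\<close>, which corresponds
  to \<open>a < v < b\<close>; the sign \<open>s\<close> is \<open>1\<close> in the first case and \<open>-1\<close> in the second.\<close>
lemma nn_integral_quantile_dist:
  assumes u: "0 < u" "u < 1" and ab: "0 \<le> a" "a \<le> b" "b \<le> 1"
    and A: "A \<in> sets borel" "\<And>v. 0 < v \<Longrightarrow> v < 1 \<Longrightarrow> Q v \<in> A \<longleftrightarrow> a < v \<and> v < b"
    and s: "\<And>v. a < v \<Longrightarrow> v < b \<Longrightarrow> \<bar>Q u - Q v\<bar> = s * (Q u - Q v)"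
  shows "enn2real (\<integral>\<^sup>+t. ennreal \<bar>Q u - t\<bar> * indicator A t \<partial>M) = s * ((b - a) * Q u - (G b - G a))"
proof -
  let ?g = "\<lambda>v. indicator {a<..<b} v *\<^sub>R (s * (Q u - Q v))"
  have nonneg: "0 \<le> ?g v" for v
  proof (cases "a < v \<and> v < b")
    case True
    then show ?thesis using s[of v, symmetric] by simp
  qed (auto simp: indicator_def)
  have "set_integrable lborel {a<..<b} Q" using ab by (intro set_integrable_quantile) auto
  moreover have "set_integrable lborel {a<..<b} (\<lambda>_. Q u)" using ab by (simp add: set_integrable_def)
  ultimately have int: "set_integrable lborel {a<..<b} (\<lambda>v. s * (Q u - Q v))"
    "(LINT v:{a<..<b}|lborel. s * (Q u - Q v)) = s * ((b - a) * Q u - (G b - G a))"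
    using ab by (simp_all add: set_integral_diff G_diff set_lebesgue_integral_def[of _ _ "\<lambda>_. Q u"])
  have "(\<integral>\<^sup>+t. ennreal \<bar>Q u - t\<bar> * indicator A t \<partial>M) =
    (\<integral>\<^sup>+t. ennreal \<bar>Q u - t\<bar> * indicator A t \<partial>distr (restrict_space lborel {0<..<1}) borel Q)"
    by (subst distr_quantile) (rule refl)
  also have "\<dots> = (\<integral>\<^sup>+v. ennreal \<bar>Q u - Q v\<bar> * indicator A (Q v) \<partial>restrict_space lborel {0<..<1})"
    using A measurable_quantile by (intro nn_integral_distr) auto
  also have "\<dots> = (\<integral>\<^sup>+v. ennreal \<bar>Q u - Q v\<bar> * indicator A (Q v) * indicator {0<..<1} v \<partial>lborel)"
    by (intro nn_integral_restrict_space) auto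
  also have "\<dots> = (\<integral>\<^sup>+v. ennreal (?g v) \<partial>lborel)"
    using ab A(2) s by (intro nn_integral_cong) (auto simp: indicator_def)
  also have "\<dots> = ennreal (LINT v|lborel. ?g v)"
  proof (rule nn_integral_eq_integral)
    show "integrable lborel ?g" using int(1) by (simp add: set_integrable_def)
    show "AE v in lborel. 0 \<le> ?g v" using nonneg by simp
  qed
  finally have eq: "(\<integral>\<^sup>+t. ennreal \<bar>Q u - t\<bar> * indicator A t \<partial>M) = ennreal (LINT v|lborel. ?g v)" .
  have "0 \<le> (LINT v|lborel. ?g v)"
    using nonneg by (intro integral_nonneg_AE AE_I2)
  from enn2real_ennreal[OF this] show ?thesis
    using int(2) by (simp only: eq set_lebesgue_integral_def)
qed

lemma measure_below: "measure M {..<x} = cdf M x"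
proof -
  have "insert x {..<x} = {..x}" by auto
  then show ?thesis
    using nonatomic[of x] finite_measure_Union[of "{..<x}" "{x}"] by (simp add: cdf_def)
qed

lemma measure_above: "measure M {x<..} = 1 - cdf M x"
  using prob_compl[of "{..x}"] by (simp add: cdf_def Compl_atMost flip: Compl_eq_Diff_UNIV)

text \<open>With \<open>Q\<close> strictly increasing, conditioning on \<open>X < Q u\<close> amounts to averaging \<open>Q\<close> over
  \<open>(0,u)\<close>; similarly for \<open>X > Q u\<close> and \<open>(u,1)\<close>.\<close>
lemma
  assumes u: "0 < u" "u < 1"
  shows mean_dist_below_quantile: "enn2real (mean_dist M {..<Q u} (Q u)) = Q u - G u / u"
    and mean_dist_above_quantile: "enn2real (mean_dist M {Q u<..} (Q u)) = (G 1 - G u) / (1 - u) - Q u"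
proof -
  have "enn2real (\<integral>\<^sup>+t. ennreal \<bar>Q u - t\<bar> * indicator {..<Q u} t \<partial>M) = 1 * ((u - 0) * Q u - (G u - G 0))"
  proof (rule nn_integral_quantile_dist[OF u])
    show "\<bar>Q u - Q v\<bar> = 1 * (Q u - Q v)" if "0 < v" "v < u" for v
      using that u quantile_less_iff[of v u] by simp
  qed (use u quantile_less_iff in auto)
  then show "enn2real (mean_dist M {..<Q u} (Q u)) = Q u - G u / u"
    using u unfolding mean_dist_def emeasure_eq_measure measure_below cdf_quantile[OF u]
    by (simp add: enn2real_divide_ennreal field_simps)
  have "enn2real (\<integral>\<^sup>+t. ennreal \<bar>Q u - t\<bar> * indicator {Q u<..} t \<partial>M) = (-1) * ((1 - u) * Q u - (G 1 - G u))"
  proof (rule nn_integral_quantile_dist[OF u])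
    show "\<bar>Q u - Q v\<bar> = (-1) * (Q u - Q v)" if "u < v" "v < 1" for v
      using that u quantile_less_iff[of u v] by simp
  qed (use u quantile_less_iff in auto)
  then show "enn2real (mean_dist M {Q u<..} (Q u)) = (G 1 - G u) / (1 - u) - Q u"
    using u unfolding mean_dist_def emeasure_eq_measure measure_above cdf_quantile[OF u]
    by (simp add: enn2real_divide_ennreal field_simps)
qed

end

section \<open>The differential equation for the integrated quantile function\<close>

text \<open>The basic solution of the homogeneous equation \<open>w' = (lam / u - (1 - lam) / (1 - u)) * w\<close>.\<close>
definition beta_kernel :: "real \<Rightarrow> real \<Rightarrow> real" where
  "beta_kernel lam u = u powr lam * (1 - u) powr (1 - lam)"

lemma beta_kernel_pos: "0 < u \<Longrightarrow> u < 1 \<Longrightarrow> beta_kernel lam u > 0"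
  by (simp add: beta_kernel_def)

lemma DERIV_beta_kernel:
  assumes "0 < u" "u < 1"
  shows "(beta_kernel lam has_real_derivative
    beta_kernel lam u * (lam / u - (1 - lam) / (1 - u))) (at u)"
proof -
  have "((\<lambda>u. u powr lam) has_real_derivative u powr lam * (0 * ln u + 1 * lam / u)) (at u)"
    using assms by (intro has_real_derivative_powr' derivative_intros) auto
  moreover have "((\<lambda>u. (1 - u) powr (1 - lam)) has_real_derivative
      (1 - u) powr (1 - lam) * (0 * ln (1 - u) + (0 - 1) * (1 - lam) / (1 - u))) (at u)"
    using assms by (intro has_real_derivative_powr' derivative_intros) auto
  ultimately show ?thesis
    unfolding beta_kernel_def [abs_def]
    by (rule DERIV_cong[OF DERIV_mult]) (simp add: algebra_simps diff_divide_distrib)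
qed

lemma continuous_on_beta_kernel:
  assumes "0 < lam" "lam < 1"
  shows "continuous_on {0..1} (beta_kernel lam)"
  unfolding beta_kernel_def [abs_def] using assms
  by (intro continuous_on_mult continuous_on_powr' continuous_intros) auto

text \<open>The functions of the family are the derivatives of \<open>u \<mapsto> d * u - C * beta_kernel lam u\<close>, which
  is what makes both the integration and the solution of the differential equation explicit.\<close>
lemma Q_fun_eq_beta_kernel:
  assumes u: "0 < u" "u < 1" and lam: "0 < lam" "lam < 1"
  shows "Q_fun lam c d u =
    d - c / (lam * (1 - lam)) * (beta_kernel lam u * (lam / u - (1 - lam) / (1 - u)))"
proof -
  \<comment> \<open>With \<open>u = a * b\<close> and \<open>1 - u = p * q\<close> the claim is an identity of rational functions.\<close>
  define a b p q where "a = u powr lam" "b = u powr (1 - lam)"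
    "p = (1 - u) powr lam" "q = (1 - u) powr (1 - lam)"
  note defs = this
  have pos: "a > 0" "b > 0" "p > 0" "q > 0" using u by (simp_all add: defs)
  have ab: "u = a * b" and pq: "1 - u = p * q"
    using u by (simp_all add: defs flip: powr_add)
  have "beta_kernel lam u * (lam / u - (1 - lam) / (1 - u)) = a * q * (lam / (a * b) - (1 - lam) / (p * q))"
    unfolding beta_kernel_def ab[symmetric] pq[symmetric] by (simp add: defs)
  also have "\<dots> = (lam * (p * q) - (1 - lam) * (a * b)) / (p * b)"
    using pos by (simp add: field_simps)
  also have "\<dots> = (lam - u) / (p * b)"
    unfolding ab[symmetric] pq[symmetric] by (simp add: algebra_simps)
  finally have eq: "beta_kernel lam u * (lam / u - (1 - lam) / (1 - u)) = (lam - u) / (p * b)" .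
  have "Q_fun lam c d u = c * (u - lam) / (lam * (1 - lam) * p * b) + d"
    by (simp add: Q_fun_def defs)
  then show ?thesis
    unfolding eq using pos lam by (simp add: field_simps)
qed

lemma isCont_Q_fun:
  assumes "0 < u" "u < 1" "0 < lam" "lam < 1"
  shows "isCont (Q_fun lam c d) u"
  unfolding Q_fun_def [abs_def] using assms by (intro continuous_intros) auto

text \<open>The function \<open>g u = m * u\<close> is a particular solution, so \<open>g u - m * u\<close> solves the homogeneous
  equation and its quotient by \<open>beta_kernel lam\<close> is constant.\<close>
lemma balance_ode_solution:
  fixes g q :: "real \<Rightarrow> real"
  assumes lam: "0 < lam" "lam < 1"
    and deriv: "\<And>u. 0 < u \<Longrightarrow> u < 1 \<Longrightarrow> (g has_real_derivative q u) (at u)"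
    and ode: "\<And>u. 0 < u \<Longrightarrow> u < 1 \<Longrightarrow> q u = lam * g u / u + (1 - lam) * (m - g u) / (1 - u)"
  obtains C where "\<And>u. 0 < u \<Longrightarrow> u < 1 \<Longrightarrow> q u = Q_fun lam (C * (lam * (1 - lam))) m u"
proof -
  let ?W = "beta_kernel lam"
  let ?r = "\<lambda>u. lam / u - (1 - lam) / (1 - u)"
  have q: "q u - m = (g u - m * u) * ?r u" if "0 < u" "u < 1" for u
    using that by (simp add: ode field_simps)
  have D: "((\<lambda>u. (g u - m * u) / ?W u) has_real_derivative 0) (at u)" if u: "0 < u" "u < 1" for u
  proof -
    have "((\<lambda>u. (g u - m * u) / ?W u) has_real_derivative
      ((q u - m) * ?W u - (g u - m * u) * (?W u * ?r u)) / (?W u * ?W u)) (at u)"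
      using deriv[OF u] DERIV_beta_kernel[OF u, of lam] beta_kernel_pos[OF u, of lam]
      by (auto intro!: derivative_eq_intros)
    then show ?thesis unfolding q[OF u] by (simp add: mult_ac)
  qed
  \<comment> \<open>The constant quotient, up to sign, read off at an arbitrary point of the interval.\<close>
  define C where "C = - (g (1/2) - m * (1/2)) / ?W (1/2)"
  have "q u = Q_fun lam (C * (lam * (1 - lam))) m u" if u: "0 < u" "u < 1" for u
  proof -
    have "(g u - m * u) / ?W u = (g (1/2) - m * (1/2)) / ?W (1/2)"
      using u D by (intro DERIV_isconst3[of 0 1 u "1/2" "\<lambda>u. (g u - m * u) / ?W u"]) auto
    then have "g u - m * u = - C * ?W u"
      using beta_kernel_pos[OF u, of lam] by (simp add: C_def field_simps)
    then show ?thesis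
      using q[OF u] lam by (simp add: Q_fun_eq_beta_kernel[OF u lam] mult.assoc)
  qed
  then show ?thesis using that by blast
qed

context nonatomic_law
begin

lemma balance_at_quantile_iff:
  assumes u: "0 < u" "u < 1"
  shows "lam * enn2real (mean_dist M {..<Q u} (Q u)) = (1 - lam) * enn2real (mean_dist M {Q u<..} (Q u)) \<longleftrightarrow>
    Q u = lam * G u / u + (1 - lam) * (G 1 - G u) / (1 - u)"
  using u by (simp add: mean_dist_below_quantile mean_dist_above_quantile algebra_simps)

text \<open>A right inverse \<open>q\<close> of the distribution function can differ from \<open>Q\<close> only at levels where that
  function is flat. But \<open>q v \<le> Q u\<close> for
  \<open>v < u\<close>, and letting \<open>v\<close> tend to \<open>u\<close> excludes this where \<open>q\<close> is continuous.\<close>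
lemma quantile_eq_if_has_quantile_function:
  assumes q: "has_quantile_function M q" and u: "0 < u" "u < 1" and cont: "isCont q u"
  shows "Q u = q u"
proof (rule antisym)
  have cdf_q: "cdf M (q v) = v" if "0 < v" "v < 1" for v
    using q that by (auto simp: has_quantile_function_def)
  show "Q u \<le> q u" using quantile_le_iff[OF u] cdf_q[OF u] by simp
  have "q v \<le> Q u" if "0 < v" "v < u" for v
    using quantile_le_iff[OF u, of "q v"] cdf_q[of v] that u by simp
  moreover have "eventually (\<lambda>v. v \<in> {0<..<u}) (at_left u)"
    using u by (intro eventually_at_leftI[of 0]) auto
  ultimately have "eventually (\<lambda>v. q v \<le> Q u) (at_left u)"
    by (auto elim: eventually_mono)
  moreover have "(q \<longlongrightarrow> q u) (at_left u)"
    using cont by (auto simp: isCont_def intro: tendsto_within_subset)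
  ultimately show "q u \<le> Q u"
    by (intro tendsto_upperbound[of q "q u" "at_left u"]) auto
qed

text \<open>An antiderivative of \<open>Q\<close> on \<open>(0,1)\<close> is \<open>d * u - C * beta_kernel lam u\<close>. It is continuous on the
  closed interval and vanishes at \<open>0\<close>, so it equals \<open>G\<close>; in particular \<open>G 1 = d\<close>.\<close>
lemma balance_if_Q_fun:
  assumes lam: "0 < lam" "lam < 1" and q: "has_quantile_function M (Q_fun lam c d)"
    and u: "0 < u" "u < 1"
  shows "Q u = lam * G u / u + (1 - lam) * (G 1 - G u) / (1 - u)"
proof -
  define C where "C = c / (lam * (1 - lam))"
  let ?P = "\<lambda>u. d * u - C * beta_kernel lam u"
  have Q: "Q v = d - C * (beta_kernel lam v * (lam / v - (1 - lam) / (1 - v)))" if "0 < v" "v < 1" for v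
    using quantile_eq_if_has_quantile_function[OF q that isCont_Q_fun[OF that lam]]
    by (simp add: Q_fun_eq_beta_kernel[OF that lam] C_def)
  have G: "G v = ?P v" if v: "0 \<le> v" "v \<le> 1" for v
  proof -
    have "(Q has_integral (?P v - ?P 0)) {0..v}"
    proof (rule fundamental_theorem_of_calculus_interior[OF v(1)])
      show "continuous_on {0..v} ?P"
        using continuous_on_subset[OF continuous_on_beta_kernel[OF lam], of "{0..v}"] v
        by (intro continuous_intros) auto
      fix x assume "x \<in> {0<..<v}"
      then have x: "0 < x" "x < 1" using v by auto
      show "(?P has_vector_derivative Q x) (at x)"
        unfolding Q[OF x] has_real_derivative_iff_has_vector_derivative[symmetric]
        using DERIV_beta_kernel[OF x, of lam] by (auto intro!: derivative_eq_intros)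
    qed
    from integral_unique[OF this] show ?thesis by (simp add: beta_kernel_def)
  qed
  have G1: "G 1 = d" by (simp add: G beta_kernel_def)
  show ?thesis
    unfolding G1 Q[OF u] G[OF less_imp_le less_imp_le, OF u] using u by (simp add: field_simps)
qed

text \<open>The equation is only known almost everywhere, and \<open>Q\<close> could have jumps. Since \<open>Q\<close> is increasing
  and the right-hand side is continuous, squeezing \<open>Q u\<close> between points where the equation holds
  extends it to all \<open>u\<close>; afterwards \<open>Q\<close> is continuous and \<open>balance_ode_solution\<close> applies.\<close>
lemma Q_fun_if_balance:
  assumes lam: "0 < lam" "lam < 1"
    and ae: "AE u in lborel. 0 < u \<and> u < 1 \<longrightarrow> Q u = lam * G u / u + (1 - lam) * (G 1 - G u) / (1 - u)"
  obtains c d where "c > 0" "has_quantile_function M (Q_fun lam c d)"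
proof -
  let ?R = "\<lambda>u. lam * G u / u + (1 - lam) * (G 1 - G u) / (1 - u)"
  have contG: "continuous_on {0..1} G"
    by (intro indefinite_integral_continuous_1 quantile_integrable_on) auto
  have contR: "continuous_on {0<..<1} ?R"
    by (intro continuous_intros continuous_on_subset[OF contG]) auto
  have dense: "\<exists>v. a < v \<and> v < b \<and> Q v = ?R v" if "0 \<le> a" "a < b" "b \<le> 1" for a b
  proof (rule ccontr)
    assume "\<not> ?thesis"
    with ae that have "AE v in lborel. v \<notin> {a<..<b}" by (auto elim!: eventually_mono)
    then have "emeasure lborel {a<..<b} = 0"
      by (subst (asm) AE_iff_measurable[of "{a<..<b}"]) auto
    with that show False by simp
  qed
  have R_lim: "(?R \<longlongrightarrow> ?R u) (at u)" if "0 < u" "u < 1" for u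
    using contR that by (simp add: continuous_on_eq_continuous_at isCont_def)
  have QR: "Q u = ?R u" if u: "0 < u" "u < 1" for u
  proof (rule antisym; rule field_le_epsilon)
    fix e :: real assume e: "e > 0"
    have "eventually (\<lambda>v. ?R v < ?R u + e \<and> ?R v > ?R u - e) (at u)"
      using R_lim[OF u] e by (intro eventually_conj order_tendstoD) auto
    then obtain \<delta> where \<delta>: "\<delta> > 0" "\<And>v. v \<noteq> u \<Longrightarrow> dist v u < \<delta> \<Longrightarrow> ?R v < ?R u + e \<and> ?R v > ?R u - e"
      unfolding eventually_at by blast
    obtain v where v: "u < v" "v < min 1 (u + \<delta>)" "Q v = ?R v"
      using dense[of u "min 1 (u + \<delta>)"] u \<delta>(1) by auto
    have "Q u < Q v" using quantile_less_iff[of u v] u v by simp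
    with \<delta>(2)[of v] v show "Q u \<le> ?R u + e" by (auto simp: dist_real_def)
    obtain w where w: "max 0 (u - \<delta>) < w" "w < u" "Q w = ?R w"
      using dense[of "max 0 (u - \<delta>)" u] u \<delta>(1) by auto
    have "Q w < Q u" using quantile_less_iff[of w u] u w by simp
    with \<delta>(2)[of w] w show "?R u \<le> Q u + e" by (auto simp: dist_real_def)
  qed
  have contQ: "isCont Q u" if u: "0 < u" "u < 1" for u
  proof -
    have "continuous_on {0<..<1} Q"
      using contR by (rule continuous_on_eq) (use QR in auto)
    then show ?thesis using u by (simp add: continuous_on_eq_continuous_at)
  qed
  have derivG: "(G has_real_derivative Q u) (at u)" if u: "0 < u" "u < 1" for u
  proof -
    have "(G has_vector_derivative Q u) (at u within {0..1})"
      using integral_has_vector_derivative_continuous_at[of Q 0 1 u "{}"] contQ[OF u] u quantile_integrable_on[of 0 1]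
      by (simp add: continuous_at_imp_continuous_at_within)
    then show ?thesis
      using u by (simp add: has_real_derivative_iff_has_vector_derivative at_within_Icc_at)
  qed
  obtain C where C: "\<And>u. 0 < u \<Longrightarrow> u < 1 \<Longrightarrow> Q u = Q_fun lam (C * (lam * (1 - lam))) (G 1) u"
    using balance_ode_solution[OF lam derivG QR] by blast
  \<comment> \<open>Compare \<open>Q\<close> at \<open>lam\<close>, where \<open>Q_fun\<close> takes the value \<open>G 1\<close> for every \<open>C\<close>, with a point to its right.\<close>
  have "0 < C"
  proof -
    define w where "w = (1 + lam) / 2"
    have w: "0 < w" "w < 1" "lam < w" using lam by (auto simp: w_def)
    have "Q lam < Q w" using quantile_less_iff[of lam w] w lam by simp
    moreover have "Q lam = G 1" using C[OF lam] by (simp add: Q_fun_def)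
    moreover have "Q w = C * ((w - lam) / ((1 - w) powr lam * w powr (1 - lam))) + G 1"
      using C[OF w(1,2)] lam by (simp add: Q_fun_def)
    ultimately have "0 < C * ((w - lam) / ((1 - w) powr lam * w powr (1 - lam)))" by simp
    moreover have "0 < (w - lam) / ((1 - w) powr lam * w powr (1 - lam))" using w by simp
    ultimately show ?thesis by (simp only: zero_less_mult_pos2)
  qed
  moreover have "has_quantile_function M (Q_fun lam (C * (lam * (1 - lam))) (G 1))"
    unfolding has_quantile_function_def using C cdf_quantile by (metis greaterThanLessThan_iff)
  ultimately show ?thesis using that lam by (meson diff_gt_0_iff_gt mult_pos_pos)
qed

lemma Q_fun_iff_AE_balance:
  assumes lam: "0 < lam" "lam < 1"
  shows "(\<exists>c d. 0 < c \<and> has_quantile_function M (Q_fun lam c d)) \<longleftrightarrow>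
    (AE x in M. lam * enn2real (mean_dist M {..<x} x) = (1 - lam) * enn2real (mean_dist M {x<..} x))"
proof -
  let ?P = "\<lambda>x. lam * enn2real (mean_dist M {..<x} x) = (1 - lam) * enn2real (mean_dist M {x<..} x)"
  have md: "(\<lambda>x. mean_dist M {..<x} x) \<in> borel_measurable borel"
    "(\<lambda>x. mean_dist M {x<..} x) \<in> borel_measurable borel"
    by (intro measurable_mean_dist_below measurable_mean_dist_above prob_space_axioms events_eq_borel)+
  have "{x \<in> space borel. ?P x} \<in> sets borel"
    using md by measurable
  then have "(AE x in M. ?P x) \<longleftrightarrow> (AE u in lborel. 0 < u \<and> u < 1 \<longrightarrow> ?P (Q u))"
    by (intro AE_iff_AE_quantile) simp
  also have "\<dots> \<longleftrightarrow> (AE u in lborel. 0 < u \<and> u < 1 \<longrightarrow>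
      Q u = lam * G u / u + (1 - lam) * (G 1 - G u) / (1 - u))"
    by (intro AE_cong) (use balance_at_quantile_iff in blast)
  also have "\<dots> \<longleftrightarrow> (\<exists>c d. 0 < c \<and> has_quantile_function M (Q_fun lam c d))"
  proof
    assume "AE u in lborel. 0 < u \<and> u < 1 \<longrightarrow> Q u = lam * G u / u + (1 - lam) * (G 1 - G u) / (1 - u)"
    from Q_fun_if_balance[OF lam this] show "\<exists>c d. 0 < c \<and> has_quantile_function M (Q_fun lam c d)"
      by metis
  next
    assume "\<exists>c d. 0 < c \<and> has_quantile_function M (Q_fun lam c d)"
    then show "AE u in lborel. 0 < u \<and> u < 1 \<longrightarrow> Q u = lam * G u / u + (1 - lam) * (G 1 - G u) / (1 - u)"
      using balance_if_Q_fun[OF lam] by (intro AE_I2) blast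
  qed
  finally show ?thesis by blast
qed

end

section \<open>Characterization of the Q-family\<close>

theorem theorem1:
  fixes M :: "'a measure" and X :: "'a \<Rightarrow> real" and Xs :: "nat \<Rightarrow> 'a \<Rightarrow> real" and n :: nat
  assumes "prob_space M"
    and "X \<in> borel_measurable M"
    and "absolutely_continuous lborel (distr M borel X)"
    and "integrable M X"
    and "n \<ge> 3"
    and "prob_space.indep_vars M (\<lambda>_. borel) Xs {1..n}"
    and "\<And>i. i \<in> {1..n} \<Longrightarrow> cdf (distr M borel (Xs i)) = cdf (distr M borel X)"
  shows "distr M borel X \<in> Q_family \<longleftrightarrow>
    (\<exists>k lam. 2 \<le> k \<and> k \<le> n - 1 \<and> 0 < lam \<and> lam < 1 \<and>
      (AE x in distr M borel (order_stat Xs n k).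
        lam * cond_exp_at M
              (\<lambda>\<omega>. 1 / real (k - 1) * (\<Sum>i = 1..k - 1. order_stat Xs n k \<omega> - order_stat Xs n i \<omega>))
              (order_stat Xs n k) x
        = (1 - lam) * cond_exp_at M
              (\<lambda>\<omega>. 1 / real (n - k) * (\<Sum>j = k + 1..n. order_stat Xs n j \<omega> - order_stat Xs n k \<omega>))
              (order_stat Xs n k) x))"
proof -
  define \<mu> where "\<mu> = distr M borel X"
  interpret prob_space M by fact
  have rv: "Xs i \<in> borel_measurable M" if "i \<in> {1..n}" for i
    using assms(6) that unfolding indep_vars_def by auto
  have law: "real_distribution \<mu>"
    unfolding \<mu>_def using assms(2) by (rule real_distribution_distr)
  have null: "emeasure \<mu> {x} = 0" for x
  proof -
    have "{x} \<in> null_sets lborel" by (auto intro: null_setsI)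
    then have "{x} \<in> null_sets \<mu>" using assms(3) unfolding absolutely_continuous_def \<mu>_def by blast
    then show ?thesis by auto
  qed
  interpret \<mu>: nonatomic_law \<mu>
  proof (intro nonatomic_law.intro nonatomic_law_axioms.intro law)
    show "measure \<mu> {x} = 0" for x using null by (simp add: measure_def)
    show "integrable \<mu> (\<lambda>x. x)"
      unfolding \<mu>_def using assms(2,4) by (subst integrable_distr_eq) auto
  qed
  have distr_Xs: "distr M borel (Xs i) = \<mu>" if "i \<in> {1..n}" for i
    using cdf_unique[OF real_distribution_distr[OF rv[OF that]] law] assms(7)[OF that]
    by (simp add: \<mu>_def)
  interpret iid_sample M Xs n \<mu>
    by unfold_locales (use assms(6) distr_Xs null in auto)
  have pos: "AE x in \<mu>. emeasure \<mu> {..<x} \<noteq> 0 \<and> emeasure \<mu> {x<..} \<noteq> 0"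
    using \<mu>.AE_cdf_interior
    by eventually_elim (simp add: \<mu>.emeasure_eq_measure \<mu>.measure_below \<mu>.measure_above)
  let ?balance = "\<lambda>lam x. lam * enn2real (mean_dist \<mu> {..<x} x) = (1 - lam) * enn2real (mean_dist \<mu> {x<..} x)"
  have md: "(\<lambda>x. mean_dist \<mu> {..<x} x) \<in> borel_measurable borel"
    "(\<lambda>x. mean_dist \<mu> {x<..} x) \<in> borel_measurable borel"
    by (intro measurable_mean_dist_below measurable_mean_dist_above \<mu>.prob_space_axioms \<mu>.events_eq_borel)+
  have iff: "(AE x in distr M borel (order_stat Xs n k).
        lam * cond_exp_at M
              (\<lambda>\<omega>. 1 / real (k - 1) * (\<Sum>i = 1..k - 1. order_stat Xs n k \<omega> - order_stat Xs n i \<omega>))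
              (order_stat Xs n k) x
        = (1 - lam) * cond_exp_at M
              (\<lambda>\<omega>. 1 / real (n - k) * (\<Sum>j = k + 1..n. order_stat Xs n j \<omega> - order_stat Xs n k \<omega>))
              (order_stat Xs n k) x) \<longleftrightarrow> (AE x in \<mu>. ?balance lam x)" (is "?L \<longleftrightarrow> _")
    if k: "2 \<le> k" "k \<le> n - 1" for k lam
  proof -
    have "?L \<longleftrightarrow> (AE x in distr M borel (order_stat Xs n k). ?balance lam x)"
      using AE_cond_exp_lower_gaps[OF k] AE_cond_exp_upper_gaps[OF k]
      by (intro eventually_subst, eventually_elim) simp
    also have "\<dots> \<longleftrightarrow> (AE x in \<mu>. ?balance lam x)"
    proof (rule AE_order_stat_iff[OF _ _ _ pos])
      have "{x \<in> space borel. ?balance lam x} \<in> sets borel" using md by measurable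
      then show "{x. ?balance lam x} \<in> sets borel" by simp
    qed (use k in auto)
    finally show ?thesis .
  qed
  have "distr M borel X \<in> Q_family \<longleftrightarrow>
      (\<exists>lam. 0 < lam \<and> lam < 1 \<and> (\<exists>c d. 0 < c \<and> has_quantile_function \<mu> (Q_fun lam c d)))"
    using law by (auto simp: Q_family_def \<mu>_def)
  also have "\<dots> \<longleftrightarrow> (\<exists>lam. 0 < lam \<and> lam < 1 \<and> (AE x in \<mu>. ?balance lam x))"
    using \<mu>.Q_fun_iff_AE_balance by blast
  also have "\<dots> \<longleftrightarrow> (\<exists>k lam. 2 \<le> k \<and> k \<le> n - 1 \<and> 0 < lam \<and> lam < 1 \<and> (AE x in \<mu>. ?balance lam x))"
  proof -
    have "2 \<le> n - 1" using assms(5) by simp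
    then show ?thesis by blast
  qed
  finally show ?thesis using iff by (simp only: cong: conj_cong)
qed

end
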